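(* Let $\Phi$ be a PCA on the configuration space $\mathcal{X}=S^{\mathbb{Z}^d}$ obtained by perturbing a surjective CA $F:\mathcal{X}\to\mathcal{X}$ with a positive additive noise. Then the uniform Bernoulli measure $\lambda$ on $\mathcal{X}$ is invariant under $\Phi$, and $\mu\Phi^t\to\lambda$ weakly as $t\to\infty$ for every shift-invariant probability measure $\mu$ on $\mathcal{X}$.
   Context: $S$ is a finite set identified with a finite Abelian group $(\mathbb{G},+)$, $d\ge1$, and $\mathcal{X}=S^{\mathbb{Z}^d}$ has the product topology. For finite $K\subseteq\mathbb{Z}^d$ and $y_K\in S^K$, the cylinder $[y_K]$ is $\{x\in\mathcal{X}: x_k=y_k\ \forall k\in K\}$. A cellular automaton (CA) is a map $F:\mathcal{X}\to\mathcal{X}$ of the form $(Fx)_k=f(x_{k+n_1},\dots,x_{k+n_m})$ for some $n_1,\dots,n_m\in\mathbb{Z}^d$ and $f:S^m\to S$. An additive noise with noise distribution $q$ (a probability distribution on $S$) has noise matrix $\theta(a,b)=q(b-a)$; it is positive if $q(b)>0$ for all $b\in S$. The perturbation of $F$ by $\theta$ is the Markov kernel $\Phi$ on $\mathcal{X}$ given by $\Phi(x,[y_K])=\prod_{k\in K}\theta\big((Fx)_k,y_k\big)$ for every cylinder. For a Borel probability measure $\mu$, $(\mu\Phi)(E)=\int\Phi(x,E)\,\mu(dx)$; $\mu$ is invariant under $\Phi$ if $\mu\Phi=\mu$. $\mu$ is shift-invariant if it is invariant under all translations $(\sigma^a x)_k=x_{a+k}$, $a\in\mathbb{Z}^d$.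 The uniform Bernoulli measure is the product measure with uniform marginals on $S$. *)

theory Defs
  imports "HOL-Probability.Probability"
begin

text \<open>
  The symbol set is a type of sort finite, abelian group, discrete topology. The lattice
  \<open>\<int>\<^sup>d\<close> is \<open>int ^ 'd\<close> with \<open>'d\<close> finite, so that \<open>d = CARD('d) \<ge> 1\<close>. The function type
  carries the product topology of HOL-Analysis, and \<open>borel\<close> refers to that topology.
\<close>

type_synonym ('d, 'a) config = "int ^ 'd \<Rightarrow> 'a"

text \<open>Only the values of \<open>y\<close> on \<open>K\<close> matter.\<close>

definition cylinder :: "(int ^ 'd) set \<Rightarrow> ('d, 'a) config \<Rightarrow> ('d, 'a) config set" where
  "cylinder K y = {x. \<forall>k\<in>K. x k = y k}"

text \<open>
  The list \<open>ns\<close> is the neighbourhood \<open>n\<^sub>1, \<dots>, n\<^sub>m\<close>; the local rule \<open>f\<close> is only ever applied to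
  lists of length \<open>m\<close>.
\<close>

definition cellular_automaton :: "(('d::finite, 'a) config \<Rightarrow> ('d, 'a) config) \<Rightarrow> bool" where
  "cellular_automaton F \<longleftrightarrow>
     (\<exists>(ns :: (int ^ 'd) list) (f :: 'a list \<Rightarrow> 'a).
        \<forall>x k. F x k = f (map (\<lambda>n. x (k + n)) ns))"

definition additive_noise :: "'a::ab_group_add pmf \<Rightarrow> 'a \<Rightarrow> 'a \<Rightarrow> real" where
  "additive_noise q a b = pmf q (b - a)"

definition positive_noise :: "'a pmf \<Rightarrow> bool" where
  "positive_noise q \<longleftrightarrow> (\<forall>b. pmf q b > 0)"

text \<open>
  Membership in the arrow space into \<open>prob_algebra borel\<close> says that the kernel is Markov. The
  cylinder values determine the kernel; existence is \<open>ex_perturbation\<close> below.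
\<close>

definition is_perturbation ::
  "(('d::finite, 'a) config \<Rightarrow> ('d, 'a) config) \<Rightarrow> ('a \<Rightarrow> 'a \<Rightarrow> real) \<Rightarrow>
   (('d, 'a::topological_space) config \<Rightarrow> ('d, 'a) config measure) \<Rightarrow> bool" where
  "is_perturbation F \<theta> \<Phi> \<longleftrightarrow>
     \<Phi> \<in> borel \<rightarrow>\<^sub>M prob_algebra borel \<and>
     (\<forall>x K y. finite K \<longrightarrow> measure (\<Phi> x) (cylinder K y) = (\<Prod>k\<in>K. \<theta> (F x k) (y k)))"

text \<open>The action of a kernel on measures is the Giry bind, see \<open>emeasure_bind\<close>.\<close>

definition invariant_under :: "'b measure \<Rightarrow> ('b \<Rightarrow> 'b measure) \<Rightarrow> bool" where
  "invariant_under \<mu> \<Phi> \<longleftrightarrow> \<mu> \<bind> \<Phi> = \<mu>"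

definition kernel_iterate :: "'b measure \<Rightarrow> ('b \<Rightarrow> 'b measure) \<Rightarrow> nat \<Rightarrow> 'b measure" where
  "kernel_iterate \<mu> \<Phi> t = ((\<lambda>\<nu>. \<nu> \<bind> \<Phi>) ^^ t) \<mu>"

definition borel_prob :: "'b::topological_space measure \<Rightarrow> bool" where
  "borel_prob \<mu> \<longleftrightarrow> sets \<mu> = sets borel \<and> prob_space \<mu>"

definition shift :: "int ^ 'd \<Rightarrow> ('d::finite, 'a) config \<Rightarrow> ('d, 'a) config" where
  "shift a x = (\<lambda>k. x (a + k))"

definition shift_invariant :: "('d::finite, 'a::topological_space) config measure \<Rightarrow> bool" where
  "shift_invariant \<mu> \<longleftrightarrow> (\<forall>a. distr \<mu> borel (shift a) = \<mu>)"

definition uniform_bernoulli :: "('d::finite, 'a::finite) config measure" where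
  "uniform_bernoulli = (\<Pi>\<^sub>M k\<in>UNIV. uniform_count_measure UNIV)"

text \<open>The library notion \<open>weak_conv_m\<close> covers measures on the real line only.\<close>

definition weakly_converges ::
  "(nat \<Rightarrow> 'b::topological_space measure) \<Rightarrow> 'b measure \<Rightarrow> bool" where
  "weakly_converges \<mu> \<nu> \<longleftrightarrow>
     (\<forall>g :: 'b \<Rightarrow> real. continuous_on UNIV g \<and> bounded (range g) \<longrightarrow>
        (\<lambda>n. \<integral>x. g x \<partial>\<mu> n) \<longlonglongrightarrow> (\<integral>x. g x \<partial>\<nu>))"


subsection \<open>Well-definedness\<close>

lemma sets_borel_config:
  "sets (borel :: ('d::finite, 'a::{finite, discrete_topology}) config measure)
     = sets (\<Pi>\<^sub>M k\<in>UNIV. count_space UNIV)"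
proof
  let ?P = "\<Pi>\<^sub>M k\<in>(UNIV::(int^'d) set). count_space (UNIV::'a set)"
  define C where "C = {cylinder K (y :: ('d, 'a) config) |K y. finite K}"
  have "C \<subseteq> (\<Union>K\<in>Collect finite. cylinder K ` PiE_dflt K undefined (\<lambda>_. UNIV))"
  proof
    fix A assume "A \<in> C"
    then obtain K y where K: "finite K" "A = cylinder K y" by (auto simp: C_def)
    let ?y = "\<lambda>k. if k \<in> K then y k else undefined"
    have "A = cylinder K ?y" using K by (simp add: cylinder_def)
    moreover have "?y \<in> PiE_dflt K undefined (\<lambda>_. UNIV)" by (simp add: PiE_dflt_def)
    ultimately show "A \<in> (\<Union>K\<in>Collect finite. cylinder K ` PiE_dflt K undefined (\<lambda>_. UNIV))"
      using K(1) by blast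
  qed
  moreover have "countable (\<Union>K\<in>Collect finite.
      cylinder K ` PiE_dflt K undefined (\<lambda>_. UNIV :: 'a set) :: ('d, 'a) config set set)"
    by (rule countable_UN[OF countable_Collect_finite])
      (simp add: countable_finite finite_PiE_dflt)
  ultimately have count: "countable C" by (rule countable_subset)
  have C_P: "A \<in> sets ?P" if A: "A \<in> C" for A
  proof -
    obtain K y where K: "finite K" "A = cylinder K y" using A unfolding C_def by blast
    have "{x \<in> space ?P. x k \<in> {y k}} \<in> sets ?P" for k
      by (rule sets_Collect_single) simp_all
    then have "{x \<in> space ?P. \<forall>k\<in>K. x k \<in> {y k}} \<in> sets ?P"
      using K(1) by (intro sets.sets_Collect_finite_All) auto
    then show ?thesis using K by (simp add: cylinder_def space_PiM)
  qed
  have "U \<in> sets ?P" if U: "open U" for U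
  proof -
    have "\<exists>A\<in>C. x \<in> A \<and> A \<subseteq> U" if x: "x \<in> U" for x
    proof -
      obtain X where X: "x \<in> (\<Pi>\<^sub>E i\<in>UNIV. X i)" "finite {i. X i \<noteq> UNIV}" "(\<Pi>\<^sub>E i\<in>UNIV. X i) \<subseteq> U"
        using product_topology_open_contains_basis[of "\<lambda>_. euclidean" UNIV U x] U x
        unfolding open_fun_def topspace_euclidean by blast
      have "cylinder {i. X i \<noteq> UNIV} x \<subseteq> (\<Pi>\<^sub>E i\<in>UNIV. X i)"
      proof
        fix z assume z: "z \<in> cylinder {i. X i \<noteq> UNIV} x"
        have "z i \<in> X i" for i
        proof (cases "X i = UNIV")
          case False
          then have "z i = x i" using z by (simp add: cylinder_def)
          then show ?thesis using X(1) by (simp add: PiE_UNIV_domain Pi_def)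
        qed simp
        then show "z \<in> (\<Pi>\<^sub>E i\<in>UNIV. X i)" by (simp add: PiE_UNIV_domain)
      qed
      then have "cylinder {i. X i \<noteq> UNIV} x \<subseteq> U" using X(3) by (rule subset_trans)
      moreover have "x \<in> cylinder {i. X i \<noteq> UNIV} x" by (simp add: cylinder_def)
      moreover have "cylinder {i. X i \<noteq> UNIV} x \<in> C" unfolding C_def using X(2) by blast
      ultimately show ?thesis by blast
    qed
    then have "\<Union>{A\<in>C. A \<subseteq> U} = U" by blast
    moreover have "\<Union>{A\<in>C. A \<subseteq> U} \<in> sets ?P"
    proof (rule sets.countable_Union)
      show "countable {A\<in>C. A \<subseteq> U}" by (rule countable_subset[OF _ count]) simp
      show "{A\<in>C. A \<subseteq> U} \<subseteq> sets ?P" using C_P by blast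
    qed
    ultimately show ?thesis by simp
  qed
  then have "sigma_sets UNIV {U. open U} \<subseteq> sets ?P"
    using sets.sigma_sets_subset[of "{U. open U}" ?P] by (simp add: space_PiM subset_iff)
  then show "sets (borel :: ('d, 'a) config measure) \<subseteq> sets ?P"
    by (simp add: borel_def)
  have "{x. x k \<in> A} \<in> sets (borel :: ('d, 'a) config measure)" for k and A :: "'a set"
    using open_vimage[OF Topological_Spaces.open_discrete[of A], of "\<lambda>x. x k"]
    by (simp add: vimage_def continuous_on_product_coordinates)
  then show "sets ?P \<subseteq> sets (borel :: ('d, 'a) config measure)"
    unfolding sets_PiM_single
    by (intro sets.sigma_sets_subset') (auto simp: PiE_def)
qed

lemma borel_prob_uniform_bernoulli:
  "borel_prob (uniform_bernoulli :: ('d::finite, 'a::{finite, discrete_topology}) config measure)"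
proof -
  have "sets (uniform_bernoulli :: ('d, 'a) config measure) = sets borel"
    unfolding uniform_bernoulli_def sets_borel_config
    by (intro sets_PiM_cong) (auto simp: sets_uniform_count_measure)
  then show ?thesis
    unfolding borel_prob_def uniform_bernoulli_def
    by (auto intro!: prob_space_PiM prob_space_uniform_count_measure)
qed

lemma ex_perturbation:
  fixes F :: "('d::finite, 'a::{finite, ab_group_add, discrete_topology}) config \<Rightarrow> ('d, 'a) config"
  assumes "cellular_automaton F"
  shows "\<exists>\<Phi>. is_perturbation F (additive_noise q) \<Phi>"
proof -
  define N where "N = (\<Pi>\<^sub>M k\<in>(UNIV::(int^'d) set). measure_pmf q)"
  interpret product_prob_space "\<lambda>_. measure_pmf q" "UNIV::(int^'d) set" ..
  have sets_N: "sets N = sets (borel :: ('d, 'a) config measure)"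
    unfolding N_def sets_borel_config by (intro sets_PiM_cong) auto
  have coord: "(\<lambda>x :: ('d, 'a) config. x k) \<in> borel \<rightarrow>\<^sub>M count_space UNIV" for k
    using measurable_component_singleton[of k UNIV "\<lambda>_. count_space (UNIV::'a set)"]
    by (simp add: measurable_cong_sets[OF sets_borel_config refl])
  obtain ns f where F: "\<And>x k. F x k = f (map (\<lambda>n. x (k + n)) ns)"
    using assms unfolding cellular_automaton_def by blast
  have map_meas: "(\<lambda>x :: ('d, 'a) config. map (\<lambda>n. x (k + n)) l) \<in> borel \<rightarrow>\<^sub>M count_space UNIV" for k l
  proof (induction l)
    case (Cons n l)
    have "(\<lambda>x :: ('d, 'a) config. a # map (\<lambda>n. x (k + n)) l) \<in> borel \<rightarrow>\<^sub>M count_space UNIV" for a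
      by (rule measurable_compose[OF Cons]) simp
    from measurable_compose_countable[OF this coord[of "k + n"]] show ?case by simp
  qed simp
  have F_meas: "(\<lambda>x. F x k) \<in> borel \<rightarrow>\<^sub>M count_space UNIV" for k
    unfolding F by (rule measurable_compose[OF map_meas]) simp
  define \<Phi> where "\<Phi> x = distr N borel (\<lambda>e k. F x k + e k)" for x
  have joint: "(\<lambda>(x, e). \<lambda>k. F x k + e k) \<in> borel \<Otimes>\<^sub>M N \<rightarrow>\<^sub>M borel"
  proof -
    have "(\<lambda>p. F (fst p) k + snd p k) \<in> borel \<Otimes>\<^sub>M N \<rightarrow>\<^sub>M count_space UNIV" for k
    proof -
      have 1: "(\<lambda>p. F (fst p) k) \<in> borel \<Otimes>\<^sub>M N \<rightarrow>\<^sub>M count_space UNIV"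
        by (rule measurable_compose[OF measurable_fst F_meas])
      have 2: "(\<lambda>p. snd p k) \<in> borel \<Otimes>\<^sub>M N \<rightarrow>\<^sub>M count_space UNIV"
        using measurable_compose[OF measurable_snd, of "\<lambda>e. e k" N "count_space UNIV"] coord[of k]
        by (simp add: measurable_cong_sets[OF sets_N refl])
      show ?thesis
        by (rule measurable_compose_countable[OF _ 1, of "\<lambda>a p. a + snd p k"])
          (rule measurable_compose[OF 2], simp)
    qed
    then have "(\<lambda>p k. F (fst p) k + snd p k) \<in> borel \<Otimes>\<^sub>M N \<rightarrow>\<^sub>M (\<Pi>\<^sub>M k\<in>UNIV. count_space UNIV)"
      by (intro measurable_PiM_single') (auto simp: PiE_def)
    then show ?thesis
      by (simp add: case_prod_beta measurable_cong_sets[OF refl sets_borel_config])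
  qed
  have prob_N: "prob_space N" unfolding N_def by (rule prob_space_axioms)
  have "\<Phi> \<in> borel \<rightarrow>\<^sub>M prob_algebra borel"
    unfolding \<Phi>_def
    by (rule measurable_distr_prob_space2[where M = N])
      (use joint prob_N in \<open>auto simp: space_prob_algebra intro!: measurable_const\<close>)
  moreover have "measure (\<Phi> x) (cylinder K y) = (\<Prod>k\<in>K. additive_noise q (F x k) (y k))"
    if K: "finite K" for x K y
  proof -
    have m: "(\<lambda>e k. F x k + e k) \<in> N \<rightarrow>\<^sub>M borel"
      using measurable_compose[OF measurable_Pair1'[of x borel N] joint] by simp
    have cyl: "cylinder K y \<in> sets borel"
    proof -
      have "{x \<in> space borel. \<forall>k\<in>K. x k = y k} \<in> sets borel"
        using K coord by measurable
      then show ?thesis by (simp add: cylinder_def)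
    qed
    have "(\<lambda>e k. F x k + e k) -` cylinder K y \<inter> space N
        = prod_emb UNIV (\<lambda>_. measure_pmf q) K (\<Pi>\<^sub>E k\<in>K. {y k - F x k})"
      by (auto simp: N_def cylinder_def prod_emb_def space_PiM PiE_def Pi_def algebra_simps
          restrict_def extensional_def)
    then have "measure (\<Phi> x) (cylinder K y) = (\<Prod>k\<in>K. measure q {y k - F x k})"
      unfolding \<Phi>_def measure_distr[OF m cyl]
      using measure_PiM_emb[of K "\<lambda>k. {y k - F x k}"] K by (simp add: N_def)
    then show ?thesis by (simp add: additive_noise_def measure_pmf_single)
  qed
  ultimately show ?thesis unfolding is_perturbation_def by blast
qed

end

theory Submission
  imports Defs "HOL-Real_Asymp.Real_Asymp"
begin

text \<open>
  Measure the distance of \<open>\<mu>\<close> from uniformity on a finite set \<open>K\<close> of sites by the relative entropy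
  \<open>D\<^sub>K(\<mu>)\<close> of its marginal with respect to the uniform distribution. A surjective CA has the
  balance property, that is, it maps uniform marginals to uniform marginals, so the data processing
  inequality bounds \<open>D\<close> on the cube of radius \<open>n\<close> after applying \<open>F\<close> by \<open>D\<close> on the cube of radius
  \<open>n + r\<close> before, where \<open>r\<close> is the radius of \<open>F\<close>. A positive additive noise is a mixture of the
  completely randomising noise, with some weight \<open>1 - c > 0\<close>, and another additive noise; hence it
  contracts the entropy deficit of one site by \<open>c\<close>, and this contraction tensorises to any number
  of sites. After \<open>t\<close> steps the deficit on a cube is thus at most \<open>c\<^sup>t\<close> times a polynomial in
  \<open>t\<close>, so it tends to \<open>0\<close>.
\<close>

subsection \<open>Entropy deficit\<close>

text \<open>For \<open>f\<close> of total mass \<open>1\<close> this is the relative entropy of \<open>f\<close> with respect to the uniform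
  distribution on \<open>A\<close>; the extension to other masses is homogeneous of degree \<open>1\<close>, so that the
  chain rule needs no conditional distributions.\<close>

definition deficit :: "'b set \<Rightarrow> ('b \<Rightarrow> real) \<Rightarrow> real" where
  "deficit A f = (\<Sum>a\<in>A. f a * ln (f a)) - sum f A * ln (sum f A) + sum f A * ln (card A)"

text \<open>The tangent bound \<open>ln x \<le> x - 1\<close> at \<open>x = b / a\<close>. Over two
  families of equal mass the left sides sum to \<open>0\<close>, which leaves nonnegativity of
  relative entropy; the third hypothesis is absolute continuity.\<close>

lemma gibbs:
  fixes a b :: real
  assumes "a \<ge> 0" "b \<ge> 0" "b = 0 \<Longrightarrow> a = 0"
  shows "a - b \<le> a * ln a - a * ln b"
proof (cases "a = 0")
  case False
  then have "a > 0" "b > 0" using assms by (auto simp: less_le)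
  then have "a * ln (b / a) \<le> a * (b / a - 1)"
    by (intro mult_left_mono ln_le_minus_one) auto
  then show ?thesis using \<open>a > 0\<close> \<open>b > 0\<close> by (simp add: ln_div algebra_simps)
qed (use assms in simp)

text \<open>\<open>gibbs\<close> compares \<open>f a b\<close> with \<open>r a * c b / S\<close>,
  the independent coupling of the two marginals, which has the same total mass as
  \<open>f\<close>.\<close>

lemma mutual_information_nonneg:
  fixes f :: "'b \<Rightarrow> 'c \<Rightarrow> real"
  assumes "finite A" "finite B" and f: "\<And>a b. a \<in> A \<Longrightarrow> b \<in> B \<Longrightarrow> 0 \<le> f a b"
  defines "r \<equiv> \<lambda>a. \<Sum>b\<in>B. f a b" and "c \<equiv> \<lambda>b. \<Sum>a\<in>A. f a b" and "S \<equiv> \<Sum>a\<in>A. \<Sum>b\<in>B. f a b"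
  shows "(\<Sum>a\<in>A. r a * ln (r a)) + (\<Sum>b\<in>B. c b * ln (c b))
    \<le> (\<Sum>a\<in>A. \<Sum>b\<in>B. f a b * ln (f a b)) + S * ln S"
proof -
  have S1: "S = sum r A" by (simp add: S_def r_def)
  have S2: "S = sum c B" unfolding S_def c_def by (rule sum.swap)
  have r0: "r a \<ge> 0" if "a \<in> A" for a using that f by (auto simp: r_def intro: sum_nonneg)
  have c0: "c b \<ge> 0" if "b \<in> B" for b using that f by (auto simp: c_def intro: sum_nonneg)
  have S0: "S \<ge> 0" using r0 by (auto simp: S1 intro: sum_nonneg)
  have le_r: "f a b \<le> r a" if "a \<in> A" "b \<in> B" for a b
    unfolding r_def using that f assms by (intro member_le_sum) auto
  have le_c: "f a b \<le> c b" if "a \<in> A" "b \<in> B" for a b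
    unfolding c_def using that f assms by (intro member_le_sum[of a A "\<lambda>a. f a b"]) auto
  have r_S: "r a \<le> S" if "a \<in> A" for a
    unfolding S1 using that r0 assms by (intro member_le_sum) auto
  have step: "f a b - r a * c b / S
      \<le> f a b * ln (f a b) - f a b * ln (r a) - f a b * ln (c b) + f a b * ln S"
    if ab: "a \<in> A" "b \<in> B" for a b
  proof (cases "f a b = 0")
    case True
    then show ?thesis using r0 c0 S0 ab by simp
  next
    case False
    then have "f a b > 0" using f ab by (simp add: less_le)
    \<comment> \<open>A positive entry forces its row, its column and the total to be positive, so
      the logarithm of the quotient splits.\<close>
    then have pos: "r a > 0" "c b > 0" "S > 0"
      using le_r[OF ab] le_c[OF ab] r_S[OF ab(1)] by linarith+
    then have "ln (r a * c b / S) = ln (r a) + ln (c b) - ln S"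
      by (simp add: ln_div ln_mult)
    moreover have "f a b - r a * c b / S \<le> f a b * ln (f a b) - f a b * ln (r a * c b / S)"
      using pos f ab by (intro gibbs) auto
    ultimately have "f a b - r a * c b / S
        \<le> f a b * ln (f a b) - f a b * (ln (r a) + ln (c b) - ln S)" by metis
    then show ?thesis by (simp only: right_diff_distrib distrib_left)
  qed
  have "(\<Sum>a\<in>A. \<Sum>b\<in>B. r a * c b / S) = S"
    by (simp add: sum_divide_distrib[symmetric] sum_product[symmetric] S1[symmetric] S2[symmetric])
  then have "0 = (\<Sum>a\<in>A. \<Sum>b\<in>B. f a b - r a * c b / S)"
    by (simp add: sum_subtractf S_def)
  also have "\<dots> \<le> (\<Sum>a\<in>A. \<Sum>b\<in>B.
      f a b * ln (f a b) - f a b * ln (r a) - f a b * ln (c b) + f a b * ln S)"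
    by (intro sum_mono step)
  also have "\<dots> = (\<Sum>a\<in>A. \<Sum>b\<in>B. f a b * ln (f a b)) - (\<Sum>a\<in>A. \<Sum>b\<in>B. f a b * ln (r a))
      - (\<Sum>a\<in>A. \<Sum>b\<in>B. f a b * ln (c b)) + (\<Sum>a\<in>A. \<Sum>b\<in>B. f a b * ln S)"
    by (simp add: sum_subtractf sum.distrib)
  also have "(\<Sum>a\<in>A. \<Sum>b\<in>B. f a b * ln (r a)) = (\<Sum>a\<in>A. r a * ln (r a))"
    by (simp add: sum_distrib_right r_def)
  also have "(\<Sum>a\<in>A. \<Sum>b\<in>B. f a b * ln (c b)) = (\<Sum>b\<in>B. c b * ln (c b))"
    by (subst sum.swap) (simp add: sum_distrib_right c_def)
  also have "(\<Sum>a\<in>A. \<Sum>b\<in>B. f a b * ln S) = S * ln S"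
    by (simp add: sum_distrib_right S_def)
  finally show ?thesis by linarith
qed

text \<open>\<open>gibbs\<close> against the constant family of the same total mass
  \<open>sum f A\<close>.\<close>

lemma deficit_nonneg:
  assumes "finite A" "\<And>a. a \<in> A \<Longrightarrow> 0 \<le> f a"
  shows "0 \<le> deficit A f"
proof (cases "sum f A = 0")
  case True
  then have "\<And>a. a \<in> A \<Longrightarrow> f a = 0" using assms by (simp add: sum_nonneg_eq_0_iff)
  then show ?thesis using True by (simp add: deficit_def)
next
  case False
  then have S: "sum f A > 0" using assms by (simp add: sum_nonneg less_le)
  then have A: "card A > 0" using assms False by (auto simp: card_gt_0_iff)
  have "0 = (\<Sum>a\<in>A. f a - sum f A / card A)" using A by (simp add: sum_subtractf)
  also have "\<dots> \<le> (\<Sum>a\<in>A. f a * ln (f a) - f a * ln (sum f A / card A))"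
    using S A assms by (intro sum_mono gibbs) auto
  also have "\<dots> = deficit A f"
    using S A by (simp add: deficit_def sum_subtractf sum_distrib_right[symmetric] ln_div right_diff_distrib)
  finally show ?thesis .
qed

text \<open>The contributions \<open>t * sum f A * ln t\<close> from the entries and from the total
  mass cancel.\<close>

lemma deficit_scale:
  assumes "0 \<le> t" "\<And>a. a \<in> A \<Longrightarrow> 0 \<le> f a"
  shows "deficit A (\<lambda>a. t * f a) = t * deficit A f"
proof (cases "t = 0")
  case False
  have *: "x * y * ln (x * y) = x * y * ln x + x * (y * ln y)" if "x > 0" "y \<ge> 0" for x y :: real
    using that by (cases "y = 0") (auto simp: ln_mult algebra_simps)
  have "(\<Sum>a\<in>A. t * f a * ln (t * f a)) = t * sum f A * ln t + t * (\<Sum>a\<in>A. f a * ln (f a))"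
    using False assms
    by (simp add: * sum.distrib sum_distrib_left[symmetric] sum_distrib_right[symmetric])
  moreover have "t * sum f A * ln (t * sum f A) = t * sum f A * ln t + t * (sum f A * ln (sum f A))"
    using False assms by (intro *) (auto intro: sum_nonneg)
  ultimately show ?thesis
    by (simp add: deficit_def sum_distrib_left[symmetric] algebra_simps)
qed (simp add: deficit_def)

lemma deficit_const:
  assumes "finite A" "A \<noteq> {}" "0 \<le> t"
  shows "deficit A (\<lambda>_. t) = 0"
  using assms by (cases "t = 0") (auto simp: deficit_def ln_mult algebra_simps card_gt_0_iff)

lemma deficit_bij_betw:
  assumes "bij_betw h A B"
  shows "deficit B f = deficit A (\<lambda>a. f (h a))"
  by (simp add: deficit_def sum.reindex_bij_betw[OF assms, symmetric]
      sum.reindex_bij_betw[OF assms, of "\<lambda>b. f b * ln (f b)", symmetric]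
      bij_betw_same_card[OF assms])

text \<open>The right side minus the left side is the unnormalised mutual information of the array
  \<open>g\<close>; the terms with \<open>ln (card A)\<close> cancel.\<close>

lemma deficit_sum_le:
  assumes "finite I" "finite A" and g: "\<And>i a. i \<in> I \<Longrightarrow> a \<in> A \<Longrightarrow> 0 \<le> g i a"
  shows "deficit A (\<lambda>a. \<Sum>i\<in>I. g i a) \<le> (\<Sum>i\<in>I. deficit A (g i))"
  using mutual_information_nonneg[of I A g, OF assms]
  by (simp add: deficit_def sum.distrib sum_subtractf sum_distrib_right[symmetric] sum.swap[of _ A I])

text \<open>Chain rule along \<open>h\<close>. All fibres have the same size, so
  \<open>ln (card B)\<close> splits into \<open>ln (card A)\<close> and the logarithm of the fibre
  size. Discarding the fibre terms yields data processing.\<close>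

lemma deficit_fibers:
  assumes "finite A" "finite B" and h: "\<And>b. b \<in> B \<Longrightarrow> h b \<in> A"
    and N: "\<And>a. a \<in> A \<Longrightarrow> card {b\<in>B. h b = a} * card A = card B" and "B \<noteq> {}"
  shows "deficit B f = deficit A (\<lambda>a. \<Sum>b | b \<in> B \<and> h b = a. f b)
    + (\<Sum>a\<in>A. deficit {b\<in>B. h b = a} f)"
proof -
  have B: "card B > 0" using assms by (simp add: card_gt_0_iff)
  have lnN: "ln (card {b\<in>B. h b = a}) = ln (card B) - ln (card A)" if "a \<in> A" for a
  proof -
    have "card {b\<in>B. h b = a} > 0" "card A > 0" using N[OF that] B by (auto intro: Nat.gr0I)
    moreover have "real (card B) = real (card {b\<in>B. h b = a}) * real (card A)"
      using N[OF that] by (simp flip: of_nat_mult)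
    ultimately show ?thesis by (simp add: ln_mult)
  qed
  have grp: "(\<Sum>a\<in>A. \<Sum>b | b \<in> B \<and> h b = a. g b) = sum g B" for g :: "_ \<Rightarrow> real"
    using assms by (intro sum.group) auto
  show ?thesis
    by (simp add: deficit_def lnN sum.distrib sum_subtractf grp sum_distrib_right[symmetric]
        right_diff_distrib)
qed

text \<open>Chain rule along the first coordinate. The slices \<open>f a\<close> keep their own
  mass, which supplies the weights of the conditional terms.\<close>

lemma deficit_Times:
  assumes "finite A" "finite B"
  shows "deficit (A \<times> B) (\<lambda>(a, b). f a b)
    = deficit A (\<lambda>a. \<Sum>b\<in>B. f a b) + (\<Sum>a\<in>A. deficit B (f a))"
proof (cases "A = {} \<or> B = {}")
  case False
  then have "card A > 0" "card B > 0" using assms by (auto simp: card_gt_0_iff)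
  then show ?thesis
    unfolding deficit_def case_prod_unfold
    by (simp add: sum.cartesian_product' sum.distrib sum_subtractf
        sum_distrib_right[symmetric] ln_mult distrib_left card_cartesian_product)
qed (auto simp: deficit_def)

lemma deficit_Times_swap:
  "deficit (A \<times> B) (\<lambda>(a, b). f a b) = deficit (B \<times> A) (\<lambda>(b, a). f a b)"
proof -
  have "bij_betw prod.swap (B \<times> A) (A \<times> B)"
    by (auto simp: bij_betw_def product_swap intro: inj_onI)
  from deficit_bij_betw[OF this] show ?thesis by (simp add: case_prod_unfold)
qed

text \<open>By the chain rule the excess over the first marginal is the sum of the deficits of the
  slices, and subadditivity bounds it below by the deficit of their sum.\<close>

lemma deficit_superadditive:
  assumes "finite A" "finite B" and f: "\<And>a b. a \<in> A \<Longrightarrow> b \<in> B \<Longrightarrow> 0 \<le> f a b"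
  shows "deficit A (\<lambda>a. \<Sum>b\<in>B. f a b) + deficit B (\<lambda>b. \<Sum>a\<in>A. f a b)
    \<le> deficit (A \<times> B) (\<lambda>(a, b). f a b)"
  unfolding deficit_Times[OF assms(1,2)] using deficit_sum_le[of A B f, OF assms] by simp

subsection \<open>Contraction under noise\<close>

text \<open>A strong data processing inequality for a stochastic matrix. Since \<open>f\<close> may
  have any mass, it applies to the unnormalised slices of a joint distribution.\<close>

definition contracts :: "'b set \<Rightarrow> ('b \<Rightarrow> 'b \<Rightarrow> real) \<Rightarrow> real \<Rightarrow> bool" where
  "contracts A P c \<longleftrightarrow>
     (\<forall>a\<in>A. \<forall>a'\<in>A. 0 \<le> P a a') \<and> (\<forall>a\<in>A. (\<Sum>a'\<in>A. P a a') = 1) \<and>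
     (\<forall>f. (\<forall>a\<in>A. 0 \<le> f a) \<longrightarrow> deficit A (\<lambda>a'. \<Sum>a\<in>A. f a * P a a') \<le> c * deficit A f)"

lemma contracts_bij_betw:
  assumes "contracts A P c" and h: "bij_betw h A B"
    and P: "\<And>a a'. a \<in> A \<Longrightarrow> a' \<in> A \<Longrightarrow> P' (h a) (h a') = P a a'"
  shows "contracts B P' c"
proof -
  have P0: "\<forall>a\<in>A. \<forall>a'\<in>A. 0 \<le> P a a'" and P1: "\<forall>a\<in>A. (\<Sum>a'\<in>A. P a a') = 1"
    and Pc: "\<And>f. (\<And>a. a \<in> A \<Longrightarrow> 0 \<le> f a)
      \<Longrightarrow> deficit A (\<lambda>a'. \<Sum>a\<in>A. f a * P a a') \<le> c * deficit A f"
    using assms(1) by (auto simp: contracts_def)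
  have hB: "b \<in> B \<longleftrightarrow> (\<exists>a\<in>A. b = h a)" for b
    using h by (auto simp: bij_betw_def)
  have "deficit B (\<lambda>b'. \<Sum>b\<in>B. f b * P' b b') \<le> c * deficit B f" if f: "\<forall>b\<in>B. 0 \<le> f b" for f
  proof -
    have "deficit A (\<lambda>a'. \<Sum>a\<in>A. f (h a) * P' (h a) (h a')) = deficit A (\<lambda>a'. \<Sum>a\<in>A. f (h a) * P a a')"
      by (simp add: deficit_def P)
    also have "\<dots> \<le> c * deficit A (\<lambda>a. f (h a))"
      using f hB by (intro Pc) auto
    finally show ?thesis
      by (simp add: deficit_bij_betw[OF h] sum.reindex_bij_betw[OF h, symmetric])
  qed
  then show ?thesis
    using P0 P1 by (auto simp: contracts_def hB P sum.reindex_bij_betw[OF h, symmetric])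
qed

text \<open>The noise acts on one coordinate at a time: \<open>P\<close> turns \<open>f\<close> into
  \<open>g\<close>, then \<open>Q\<close> turns \<open>g\<close> into \<open>h\<close>. Each time
  the chain rule is taken with the noisy coordinate last, so that the conditional part shrinks by
  \<open>c\<close> and the other marginal stays fixed.\<close>

lemma contracts_Times:
  assumes fin: "finite A" "finite B" and P: "contracts A P c" and Q: "contracts B Q c"
    and c: "0 \<le> c" "c \<le> 1"
  shows "contracts (A \<times> B) (\<lambda>(a, b) (a', b'). P a a' * Q b b') c"
proof -
  have P0: "\<And>a a'. a \<in> A \<Longrightarrow> a' \<in> A \<Longrightarrow> 0 \<le> P a a'" and P1: "\<And>a. a \<in> A \<Longrightarrow> (\<Sum>a'\<in>A. P a a') = 1"
    and Pc: "\<And>f. (\<And>a. a \<in> A \<Longrightarrow> 0 \<le> f a)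
      \<Longrightarrow> deficit A (\<lambda>a'. \<Sum>a\<in>A. f a * P a a') \<le> c * deficit A f"
    using P by (auto simp: contracts_def)
  have Q0: "\<And>a a'. a \<in> B \<Longrightarrow> a' \<in> B \<Longrightarrow> 0 \<le> Q a a'" and Q1: "\<And>a. a \<in> B \<Longrightarrow> (\<Sum>a'\<in>B. Q a a') = 1"
    and Qc: "\<And>f. (\<And>a. a \<in> B \<Longrightarrow> 0 \<le> f a)
      \<Longrightarrow> deficit B (\<lambda>a'. \<Sum>a\<in>B. f a * Q a a') \<le> c * deficit B f"
    using Q by (auto simp: contracts_def)
  have "deficit (A \<times> B) (\<lambda>p'. \<Sum>p\<in>A \<times> B. F p * (case p of (a, b) \<Rightarrow> \<lambda>(a', b'). P a a' * Q b b') p')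
      \<le> c * deficit (A \<times> B) F" if "\<forall>p\<in>A \<times> B. 0 \<le> F p" for F
  proof -
    define f where "f a b = F (a, b)" for a b
    have f: "0 \<le> f a b" if "a \<in> A" "b \<in> B" for a b using \<open>\<forall>p\<in>A \<times> B. 0 \<le> F p\<close> that by (simp add: f_def)
    have Ff: "F = (\<lambda>(a, b). f a b)" by (auto simp: f_def)
    define g where "g a' b = (\<Sum>a\<in>A. f a b * P a a')" for a' b
    define h where "h a' b' = (\<Sum>b\<in>B. g a' b * Q b b')" for a' b'
    have g: "0 \<le> g a b" if "a \<in> A" "b \<in> B" for a b
      using that f P0 by (auto simp: g_def intro!: sum_nonneg)
    have gA: "(\<Sum>b\<in>B. g a' b) = (\<Sum>a\<in>A. (\<Sum>b\<in>B. f a b) * P a a')" for a'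
      unfolding g_def by (subst sum.swap) (simp add: sum_distrib_right)
    have gB: "(\<Sum>a\<in>A. g a b) = (\<Sum>a\<in>A. f a b)" for b
      unfolding g_def by (subst sum.swap) (simp add: sum_distrib_left[symmetric] P1)
    have hA: "(\<Sum>b\<in>B. h a b) = (\<Sum>b\<in>B. g a b)" for a
      unfolding h_def by (subst sum.swap) (simp add: sum_distrib_left[symmetric] Q1)
    have "deficit (A \<times> B) (\<lambda>(a, b). h a b)
        \<le> deficit A (\<lambda>a. \<Sum>b\<in>B. g a b) + c * (\<Sum>a\<in>A. deficit B (g a))"
      unfolding deficit_Times[OF fin] hA sum_distrib_left
      unfolding h_def by (intro add_left_mono sum_mono Qc g)
    \<comment> \<open>The chain rule trades the conditional part for the joint deficit, leaving
      weight \<open>1 - c\<close> on the marginal.\<close>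
    also have "\<dots> = (1 - c) * deficit A (\<lambda>a. \<Sum>b\<in>B. g a b) + c * deficit (A \<times> B) (\<lambda>(a, b). g a b)"
      unfolding deficit_Times[OF fin] by (simp add: algebra_simps)
    also have "\<dots> \<le> (1 - c) * (c * deficit A (\<lambda>a. \<Sum>b\<in>B. f a b))
        + c * ((1 - c) * deficit B (\<lambda>b. \<Sum>a\<in>A. f a b) + c * deficit (A \<times> B) F)"
    proof (intro add_mono mult_left_mono)
      show "deficit A (\<lambda>a. \<Sum>b\<in>B. g a b) \<le> c * deficit A (\<lambda>a. \<Sum>b\<in>B. f a b)"
        unfolding gA by (intro Pc) (auto intro: sum_nonneg f)
      \<comment> \<open>In passing from \<open>f\<close> to \<open>g\<close> the noisy coordinate is
        the first, so here the chain rule runs along the second.\<close>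
      have "deficit (A \<times> B) (\<lambda>(a, b). g a b)
          = deficit B (\<lambda>b. \<Sum>a\<in>A. f a b) + (\<Sum>b\<in>B. deficit A (\<lambda>a. g a b))"
        unfolding deficit_Times_swap[of A] deficit_Times[OF fin(2,1)] gB ..
      also have "\<dots> \<le> deficit B (\<lambda>b. \<Sum>a\<in>A. f a b) + c * (\<Sum>b\<in>B. deficit A (\<lambda>a. f a b))"
        unfolding sum_distrib_left
        unfolding g_def by (intro add_left_mono sum_mono Pc f)
      also have "\<dots> = (1 - c) * deficit B (\<lambda>b. \<Sum>a\<in>A. f a b) + c * deficit (A \<times> B) F"
        unfolding Ff deficit_Times_swap[of A] deficit_Times[OF fin(2,1)] by (simp add: algebra_simps)
      finally show "deficit (A \<times> B) (\<lambda>(a, b). g a b)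
          \<le> (1 - c) * deficit B (\<lambda>b. \<Sum>a\<in>A. f a b) + c * deficit (A \<times> B) F" .
    qed (use c in auto)
    also have "\<dots> = c * (1 - c) * (deficit A (\<lambda>a. \<Sum>b\<in>B. f a b) + deficit B (\<lambda>b. \<Sum>a\<in>A. f a b))
        + c * c * deficit (A \<times> B) F"
      by (simp add: algebra_simps)
    \<comment> \<open>Superadditivity bounds the two marginal deficits by one joint deficit; the
      weights \<open>c * (1 - c)\<close> and \<open>c * c\<close> then add up to
      \<open>c\<close>.\<close>
    also have "\<dots> \<le> c * (1 - c) * deficit (A \<times> B) F + c * c * deficit (A \<times> B) F"
      using c unfolding Ff
      by (intro add_right_mono mult_left_mono deficit_superadditive fin f) auto
    also have "\<dots> = c * deficit (A \<times> B) F" by (simp add: algebra_simps)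
    also have "(\<lambda>(a, b). h a b)
        = (\<lambda>p'. \<Sum>p\<in>A \<times> B. F p * (case p of (a, b) \<Rightarrow> \<lambda>(a', b'). P a a' * Q b b') p')"
    proof
      fix p' show "(case p' of (a, b) \<Rightarrow> h a b)
        = (\<Sum>p\<in>A \<times> B. F p * (case p of (a, b) \<Rightarrow> \<lambda>(a', b'). P a a' * Q b b') p')"
      proof (cases p')
        case (Pair a' b')
        have "h a' b' = (\<Sum>b\<in>B. \<Sum>a\<in>A. f a b * P a a' * Q b b')"
          by (simp add: h_def g_def sum_distrib_right)
        also have "\<dots> = (\<Sum>a\<in>A. \<Sum>b\<in>B. f a b * P a a' * Q b b')" by (rule sum.swap)
        finally show ?thesis
          by (simp add: Pair sum.cartesian_product f_def case_prod_beta mult.assoc)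
      qed
    qed
    finally show ?thesis .
  qed
  moreover have "(\<Sum>p\<in>A \<times> B. P a (fst p) * Q b (snd p)) = 1" if "a \<in> A" "b \<in> B" for a b
    using that P1 Q1 by (simp add: sum.cartesian_product' sum_product[symmetric])
  ultimately show ?thesis
    using P0 Q0 by (auto simp: contracts_def case_prod_beta)
qed

text \<open>Removing mass \<open>m\<close> from every value of \<open>q\<close> writes the noisy
  distribution as a constant plus translates of \<open>f\<close> with weights
  \<open>pmf q e - m\<close>. The constant has no deficit, a translate has that of \<open>f\<close>,
  and the weights sum to the contraction factor.\<close>

lemma contracts_additive_noise:
  fixes q :: "'a::{finite, ab_group_add} pmf" and m :: real
  assumes m: "\<And>b. m \<le> pmf q b" "0 \<le> m"
  shows "contracts UNIV (additive_noise q) (1 - CARD('a) * m)"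
proof -
  have sh: "(\<Sum>b\<in>UNIV. g (b - a)) = (\<Sum>b\<in>UNIV. g b)" for g :: "'a \<Rightarrow> real" and a
    by (rule sum.reindex_bij_witness[of _ "\<lambda>b. b + a" "\<lambda>b. b - a"]) auto
  have sh': "(\<Sum>b\<in>UNIV. g (a - b)) = (\<Sum>b\<in>UNIV. g b)" for g :: "'a \<Rightarrow> real" and a
    by (rule sum.reindex_bij_witness[of _ "\<lambda>b. a - b" "\<lambda>b. a - b"]) auto
  have q1: "(\<Sum>b\<in>UNIV. pmf q b) = 1" by (rule sum_pmf_eq_1) auto
  have "deficit UNIV (\<lambda>b. \<Sum>a\<in>UNIV. f a * pmf q (b - a)) \<le> (1 - CARD('a) * m) * deficit UNIV f"
    if f: "\<forall>a. 0 \<le> f a" for f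
  proof -
    \<comment> \<open>\<open>None\<close> indexes the constant part, \<open>Some e\<close> the
      translate by \<open>e\<close>.\<close>
    define g where "g i b = (case i of None \<Rightarrow> m * sum f UNIV
      | Some e \<Rightarrow> (pmf q e - m) * f (b - e))" for i :: "'a option" and b
    have *: "(\<Sum>i\<in>UNIV. v i) = v None + (\<Sum>e\<in>UNIV. v (Some e))" for v :: "'a option \<Rightarrow> real"
      by (simp add: UNIV_option_conv sum.reindex)
    have "(\<Sum>a\<in>UNIV. f a * pmf q (b - a)) = (\<Sum>i\<in>UNIV. g i b)" for b
    proof -
      have "(\<Sum>a\<in>UNIV. f a * pmf q (b - a)) = (\<Sum>e\<in>UNIV. f (b - e) * pmf q e)"
        using sh'[of "\<lambda>a. f a * pmf q (b - a)" b] by simp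
      also have "\<dots> = (\<Sum>e\<in>UNIV. m * f (b - e) + (pmf q e - m) * f (b - e))"
        by (simp add: algebra_simps)
      also have "\<dots> = (\<Sum>i\<in>UNIV. g i b)"
        by (simp add: * g_def sum.distrib sum_distrib_left[symmetric] sh')
      finally show ?thesis .
    qed
    then have "deficit UNIV (\<lambda>b. \<Sum>a\<in>UNIV. f a * pmf q (b - a)) = deficit UNIV (\<lambda>b. \<Sum>i\<in>UNIV. g i b)"
      by simp
    also have "\<dots> \<le> (\<Sum>i\<in>UNIV. deficit UNIV (g i))"
      using f m by (intro deficit_sum_le) (auto simp: g_def sum_nonneg split: option.split)
    also have "\<dots> = (\<Sum>e\<in>UNIV. (pmf q e - m) * deficit UNIV f)"
    proof -
      have "deficit UNIV (\<lambda>b. f (b - e)) = deficit UNIV f" for e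
        using deficit_bij_betw[of "\<lambda>b. b - e" UNIV UNIV f]
        by (simp add: bij_betw_def inj_on_def surj_def)
      then have "deficit UNIV (g (Some e)) = (pmf q e - m) * deficit UNIV f" for e
        using f m by (simp add: g_def[abs_def] deficit_scale)
      moreover have "deficit UNIV (g None) = 0"
        using deficit_const[of "UNIV :: 'a set" "m * sum f UNIV"] f m by (simp add: g_def[abs_def] sum_nonneg)
      ultimately show ?thesis by (simp add: *)
    qed
    also have "\<dots> = (1 - CARD('a) * m) * deficit UNIV f"
      by (simp add: sum_distrib_right[symmetric] sum_subtractf q1)
    finally show ?thesis .
  qed
  then show ?thesis
    by (simp add: contracts_def additive_noise_def sh[of "pmf q"] q1)
qed

section \<open>Noise on finite blocks of sites\<close>

abbreviation patterns :: "'k set \<Rightarrow> ('k \<Rightarrow> 'a) set" where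
  "patterns K \<equiv> K \<rightarrow>\<^sub>E UNIV"

text \<open>One site at a time is split off as a Cartesian factor; tensorisation keeps the same
  \<open>c\<close> for every \<open>K\<close>.\<close>

lemma contracts_patterns:
  fixes P :: "'a::finite \<Rightarrow> 'a \<Rightarrow> real"
  assumes "finite K" "contracts UNIV P c" "0 \<le> c" "c \<le> 1"
  shows "contracts (patterns K) (\<lambda>x y. \<Prod>k\<in>K. P (x k) (y k)) c"
  using assms(1)
proof (induction K)
  case empty
  then show ?case by (simp add: contracts_def deficit_def)
next
  case (insert k K)
  let ?h = "\<lambda>(a, x). x(k := a) :: _ \<Rightarrow> 'a"
  have fin: "finite (patterns K :: (_ \<Rightarrow> 'a) set)" using insert by (intro finite_PiE) auto
  have h: "bij_betw ?h (UNIV \<times> patterns K) (patterns (insert k K))"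
    using inj_combinator[OF insert(2), of "\<lambda>_. UNIV"] by (auto simp: bij_betw_def PiE_insert_eq)
  show ?case
    by (rule contracts_bij_betw[OF contracts_Times[OF _ fin assms(2) insert(3) assms(3,4)] h])
      (use insert in \<open>auto intro!: prod.cong\<close>)
qed

text \<open>A Hellinger-type bound in the role of Pinsker's inequality: a small deficit forces each
  \<open>f a\<close> close to \<open>1 / card A\<close>. It comes from summing a scalar inequality
  at \<open>card A * f b\<close> and keeping one term.\<close>

lemma deficit_bound_pointwise:
  fixes f :: "'b \<Rightarrow> real"
  assumes "finite A" "\<And>a. a \<in> A \<Longrightarrow> 0 \<le> f a" "sum f A = 1" "a \<in> A"
  shows "(sqrt (card A * f a) - 1)\<^sup>2 \<le> card A * deficit A f"
proof -
  define N where "N = real (card A)"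
  have N: "N > 0" using assms by (auto simp: N_def card_gt_0_iff)
  have *: "(sqrt x - 1)\<^sup>2 \<le> x * ln x - x + 1" if x: "x \<ge> 0" for x :: real
  proof (cases "x = 0")
    case False
    \<comment> \<open>\<open>gibbs\<close> at \<open>sqrt x\<close> and \<open>1\<close>, multiplied
      by \<open>sqrt x\<close>; since \<open>ln (sqrt x) = ln x / 2\<close>, doubling gives the
      claim.\<close>
    have "sqrt x * (sqrt x - 1) \<le> sqrt x * (sqrt x * ln (sqrt x))"
      using gibbs[of "sqrt x" 1] x by (intro mult_left_mono) auto
    then have "x - sqrt x \<le> x * ln (sqrt x)"
      using x by (simp add: right_diff_distrib mult.assoc[symmetric])
    then show ?thesis using x False by (simp add: power2_eq_square ln_sqrt algebra_simps)
  qed simp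
  \<comment> \<open>In this form the terms \<open>- f b\<close> and \<open>1 / N\<close> cancel in
    the sum over \<open>A\<close>, because \<open>f\<close> has mass \<open>1\<close>.\<close>
  have t: "N * (f b * ln (f b) + f b * ln N - f b + 1 / N) = N * f b * ln (N * f b) - N * f b + 1"
    if "b \<in> A" for b
    using N assms(2)[OF that] by (cases "f b = 0") (auto simp: ln_mult algebra_simps)
  have "(sqrt (N * f a) - 1)\<^sup>2 \<le> (\<Sum>b\<in>A. (sqrt (N * f b) - 1)\<^sup>2)"
    using assms by (intro member_le_sum[of a A "\<lambda>b. (sqrt (N * f b) - 1)\<^sup>2"]) auto
  also have "\<dots> \<le> (\<Sum>b\<in>A. N * (f b * ln (f b) + f b * ln N - f b + 1 / N))"
  proof (rule sum_mono)
    fix b assume b: "b \<in> A"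
    show "(sqrt (N * f b) - 1)\<^sup>2 \<le> N * (f b * ln (f b) + f b * ln N - f b + 1 / N)"
      unfolding t[OF b] using N assms(2)[OF b] by (intro *) simp
  qed
  also have "\<dots> = N * deficit A f"
    using assms(3) N
    by (simp add: deficit_def sum_distrib_left[symmetric] sum.distrib sum_subtractf
        sum_distrib_right[symmetric] flip: N_def)
  finally show ?thesis by (simp add: N_def)
qed

subsection \<open>Balance of surjective cellular automata\<close>

definition cube :: "nat \<Rightarrow> (int ^ 'd) set" where
  "cube n = {v. \<forall>i. \<bar>v $ i\<bar> \<le> int n}"

lemma cube_bij_betw:
  "bij_betw (($)) (cube n :: (int ^ 'd::finite) set) (UNIV \<rightarrow>\<^sub>E {- int n..int n})"
  by (rule bij_betw_byWitness[where f' = vec_lambda])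
    (auto simp: cube_def abs_le_iff PiE_def Pi_def minus_le_iff)

lemma finite_cube [simp]: "finite (cube n :: (int ^ 'd::finite) set)"
  by (simp add: bij_betw_finite[OF cube_bij_betw] finite_PiE)

lemma card_cube: "card (cube n :: (int ^ 'd::finite) set) = (2 * n + 1) ^ CARD('d)"
  by (simp add: bij_betw_same_card[OF cube_bij_betw] card_PiE nat_add_distrib nat_mult_distrib)

lemma cube_mono: "m \<le> n \<Longrightarrow> cube m \<subseteq> cube n"
  unfolding cube_def by (auto intro: order_trans)

lemma cube_add: "u \<in> cube m \<Longrightarrow> v \<in> cube n \<Longrightarrow> u + v \<in> cube (m + n)"
  unfolding cube_def by (auto intro: order_trans[OF abs_triangle_ineq] add_mono)

lemma finite_subset_cube:
  fixes K :: "(int ^ 'd::finite) set"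
  assumes "finite K"
  shows "\<exists>n. K \<subseteq> cube n"
  using assms
proof induction
  case (insert v K)
  then obtain n where n: "K \<subseteq> cube n" by blast
  define m where "m = nat (\<Sum>i\<in>UNIV. \<bar>v $ i\<bar>)"
  have "\<bar>v $ i\<bar> \<le> (\<Sum>i\<in>UNIV. \<bar>v $ i\<bar>)" for i
    by (rule member_le_sum) auto
  then have "v \<in> cube m" by (simp add: cube_def m_def sum_nonneg)
  then have "insert v K \<subseteq> cube (max m n)"
    using n cube_mono[of m "max m n"] cube_mono[of n "max m n"] by auto
  then show ?case by blast
qed simp

text \<open>Division with remainder by an odd modulus: the cubes \<open>side R *s u + cube R\<close> tile the
  lattice.\<close>

text \<open>A constant, because the simplifier would multiply out \<open>2 * int R + 1\<close>.\<close>

definition side :: "nat \<Rightarrow> int" where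
  "side R = 2 * int R + 1"

lemma side_pos: "0 < side R"
  by (simp add: side_def)

text \<open>Adding \<open>R\<close> before dividing centres the remainders in
  \<open>{- R..R}\<close>, so that they fill a cube around the origin.\<close>

definition tile_quo :: "nat \<Rightarrow> int ^ 'd \<Rightarrow> int ^ 'd::finite" where
  "tile_quo R v = (\<chi> i. (v $ i + int R) div side R)"

definition tile_rem :: "nat \<Rightarrow> int ^ 'd \<Rightarrow> int ^ 'd::finite" where
  "tile_rem R v = (\<chi> i. (v $ i + int R) mod side R - int R)"

lemma tile_decomp: "side R *s tile_quo R v + tile_rem R v = v"
proof -
  have "side R * ((x + int R) div side R) + ((x + int R) mod side R - int R) = x"
    for x using mult_div_mod_eq[of "side R" "x + int R"] by linarith
  then show ?thesis by (simp add: vec_eq_iff tile_quo_def tile_rem_def)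
qed

lemma tile_rem_in_cube: "tile_rem R v \<in> cube R"
proof -
  have "\<bar>x mod side R - int R\<bar> \<le> int R" for x
    using pos_mod_bound[OF side_pos, of x R] pos_mod_sign[OF side_pos, of x R]
    by (simp add: side_def abs_le_iff)
  then show ?thesis by (simp add: cube_def tile_rem_def)
qed

lemma tile_quo_in_cube:
  assumes "v \<in> cube ((2 * R + 1) * L + R)"
  shows "tile_quo R v \<in> cube L"
proof -
  have "\<bar>(x + int R) div side R\<bar> \<le> int L"
    if "\<bar>x\<bar> \<le> int ((2 * R + 1) * L + R)" for x
  proof -
    \<comment> \<open>\<open>x + R\<close> runs from \<open>- L * side R\<close> to
      \<open>L * side R + (side R - 1)\<close>, exactly the integers with quotient between
      \<open>- L\<close> and \<open>L\<close>.\<close>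
    have "- int L * side R \<le> x + int R" "x + int R \<le> (side R - 1) + int L * side R"
      using that by (auto simp: side_def algebra_simps)
    then have "- int L * side R div side R \<le> (x + int R) div side R"
      "(x + int R) div side R \<le> ((side R - 1) + int L * side R) div side R"
      by (auto intro: zdiv_mono1 side_pos)
    moreover have "- int L * side R div side R = - int L"
      "((side R - 1) + int L * side R) div side R = int L"
      using side_pos[of R] nonzero_mult_div_cancel_right[of "side R" "- int L"] by simp_all
    ultimately show ?thesis by linarith
  qed
  then show ?thesis using assms by (simp add: cube_def tile_quo_def)
qed

lemma tile_unique:
  assumes "k \<in> cube R"
  shows "tile_quo R (side R *s u + k) = u" "tile_rem R (side R *s u + k) = k"
proof -
  have "(side R * a + b + int R) div side R = a
      \<and> (side R * a + b + int R) mod side R = b + int R"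
    if "\<bar>b\<bar> \<le> int R" for a b
  proof -
    have *: "side R * a + b + int R = (b + int R) + side R * a" by simp
    have "0 \<le> b + int R" "b + int R < side R"
      using that by (auto simp: side_def)
    then show ?thesis using side_pos[of R] unfolding *
      by (simp only: div_mult_self2 mod_mult_self2 div_pos_pos_trivial mod_pos_pos_trivial) simp
  qed
  then show "tile_quo R (side R *s u + k) = u" "tile_rem R (side R *s u + k) = k"
    using assms by (simp_all add: vec_eq_iff tile_quo_def tile_rem_def cube_def)
qed

lemma tile_in_cube:
  assumes "u \<in> cube L" "k \<in> cube n"
  shows "side R *s u + k \<in> cube ((2 * R + 1) * L + n)"
proof (rule cube_add[OF _ assms(2)])
  have "side R * \<bar>x\<bar> \<le> side R * int L" if "\<bar>x\<bar> \<le> int L" for x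
    using that side_pos[of R] by (intro mult_left_mono) auto
  moreover have "int ((2 * R + 1) * L) = side R * int L" "\<bar>side R\<bar> = side R"
    by (simp_all add: side_def algebra_simps)
  ultimately show "side R *s u \<in> cube ((2 * R + 1) * L)"
    using assms(1) by (simp add: cube_def abs_mult del: of_nat_mult of_nat_add)
qed

section \<open>Counting preimages of patterns\<close>

lemma finite_patterns [simp]: "finite K \<Longrightarrow> finite (patterns K :: ('k \<Rightarrow> 'a::finite) set)"
  by (intro finite_PiE) auto

lemma card_patterns: "finite K \<Longrightarrow> card (patterns K :: ('k \<Rightarrow> 'a::finite) set) = CARD('a) ^ card K"
  by (simp add: card_PiE)

text \<open>All that the counting needs from a CA of radius \<open>r\<close>: translation
  equivariance, to move tiles to the origin, and the range of dependence on cubes.\<close>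

locale local_map =
  fixes F :: "('d::finite, 'a::finite) config \<Rightarrow> ('d, 'a) config" and r :: nat
  assumes shift: "F (shift a x) = shift a (F x)"
    and local: "(\<And>j. j \<in> cube (n + r) \<Longrightarrow> x j = y j) \<Longrightarrow> k \<in> cube n \<Longrightarrow> F x k = F y k"
begin

lemma local_restrict: "k \<in> cube n \<Longrightarrow> F (restrict x (cube (n + r))) k = F x k"
  by (rule local) auto

text \<open>A pattern is a full configuration with value \<open>undefined\<close> off its cube.
  \<open>F\<close> applies to it directly, and on \<open>cube n\<close> its image ignores those
  default values.\<close>

definition preimages :: "nat \<Rightarrow> ('d, 'a) config \<Rightarrow> ('d, 'a) config set" where
  "preimages n w = {z \<in> patterns (cube (n + r)). \<forall>k\<in>cube n. F z k = w k}"

text \<open>Surjectivity is used on the cube with \<open>2 * L + 1\<close> tiles per side, for the patterns that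
  carry a copy of \<open>w\<close> in the middle of every tile.\<close>

lemma card_preimages_tiled:
  assumes "surj F"
  shows "CARD('a) ^ card (cube ((2 * (n + r) + 1) * L + n) :: (int ^ 'd) set)
    \<le> (card (patterns (cube n) :: ('d, 'a) config set) * card (preimages n w))
        ^ card (cube L :: (int ^ 'd) set)"
proof -
  define R where "R = n + r"
  define T where "T = (cube L :: (int ^ 'd) set)"
  \<comment> \<open>\<open>W\<close> is the union of the tiles with index in \<open>T\<close>; the
    smaller cube \<open>B\<close> is where the image is determined by the values on
    \<open>W\<close>.\<close>
  define W where "W = (cube ((2 * R + 1) * L + n + r) :: (int ^ 'd) set)"
  define B where "B = (cube ((2 * R + 1) * L + n) :: (int ^ 'd) set)"
  define C where "C = {v\<in>B. tile_rem R v \<in> cube n}"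
  define X where "X = {z \<in> patterns W. \<forall>u\<in>T. \<forall>k\<in>cube n. F z (side R *s u + k) = w k}"
  have finX: "finite X" unfolding X_def W_def by simp
  have nR: "cube n \<subseteq> cube R" unfolding R_def by (rule cube_mono) simp
  have W: "W = cube ((2 * R + 1) * L + R)" by (simp add: W_def R_def add.assoc)
  have B_W: "B \<subseteq> W" unfolding B_def W_def by (rule cube_mono) simp
  have "card X \<le> card (T \<rightarrow>\<^sub>E preimages n w)"
  proof (rule card_inj_on_le)
    \<comment> \<open>\<open>z\<close> is cut into its tiles, each moved to the origin, where it
      becomes a preimage of \<open>w\<close>. The tiles cover \<open>W\<close>, so nothing is
      lost.\<close>
    let ?h = "\<lambda>z. \<lambda>u\<in>T. restrict (shift (side R *s u) z) (cube R)"
    show "finite (T \<rightarrow>\<^sub>E preimages n w)"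
      unfolding T_def preimages_def by (intro finite_PiE) auto
    show "?h ` X \<subseteq> T \<rightarrow>\<^sub>E preimages n w"
    proof -
      have "F (restrict (shift (side R *s u) z) (cube R)) k = w k"
        if "z \<in> X" "u \<in> T" "k \<in> cube n" for z u k
        using that local_restrict[of k n] by (simp add: R_def shift) (simp add: shift_def X_def R_def)
      then show ?thesis by (auto simp: preimages_def R_def)
    qed
    show "inj_on ?h X"
    proof (rule inj_onI)
      fix z z' assume z: "z \<in> X" "z' \<in> X" and eq: "?h z = ?h z'"
      show "z = z'"
      proof
        fix v
        show "z v = z' v"
        proof (cases "v \<in> W")
          case True
          then have q: "tile_quo R v \<in> T" unfolding T_def W by (rule tile_quo_in_cube)
          have "?h z (tile_quo R v) (tile_rem R v) = ?h z' (tile_quo R v) (tile_rem R v)"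
            using eq by simp
          then show ?thesis
            using q tile_rem_in_cube[of R v] by (simp add: shift_def tile_decomp)
        next
          case False
          then show ?thesis using z by (auto simp: X_def PiE_def extensional_def)
        qed
      qed
    qed
  qed
  also have "\<dots> = card (preimages n w) ^ card T"
    by (simp add: card_PiE T_def)
  finally have upper: "card X \<le> card (preimages n w) ^ card T" .

  have "card (patterns (B - C) :: ('d, 'a) config set) \<le> card X"
  proof (rule card_inj_on_le[OF _ _ finX])
    \<comment> \<open>The target has \<open>w\<close> in the middle of every tile and the free
      values \<open>g\<close> elsewhere. A preimage under \<open>F\<close>, cut down to
      \<open>W\<close>, still determines \<open>g\<close> on \<open>B - C\<close>, so distinct
      \<open>g\<close> yield distinct elements of \<open>X\<close>.\<close>
    define y where "y g v = (if tile_rem R v \<in> cube n then w (tile_rem R v) else g v)"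
      for g :: "('d, 'a) config" and v
    define x where "x g = inv F (y g)" for g
    have Fx: "F (x g) = y g" for g
      by (simp add: x_def surj_f_inv_f[OF assms])
    have res: "F (restrict (x g) W) k = y g k" if "k \<in> B" for g k
      using that local_restrict[of k _ "x g"] by (simp add: Fx B_def W_def)
    show "(\<lambda>g. restrict (x g) W) ` patterns (B - C) \<subseteq> X"
    proof -
      have "F (restrict (x g) W) (side R *s u + k) = w k"
        if "u \<in> T" "k \<in> cube n" for g u k
      proof -
        have "side R *s u + k \<in> B"
          using that unfolding B_def T_def by (rule tile_in_cube)
        moreover have "tile_rem R (side R *s u + k) = k"
          using that nR by (intro tile_unique) auto
        ultimately show ?thesis using that by (simp add: res y_def)
      qed
      then show ?thesis by (auto simp: X_def)
    qed
    show "inj_on (\<lambda>g. restrict (x g) W) (patterns (B - C))"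
    proof (rule inj_onI)
      fix g g' :: "('d, 'a) config"
      assume g: "g \<in> patterns (B - C)" "g' \<in> patterns (B - C)"
        and eq: "restrict (x g) W = restrict (x g') W"
      have "g v = g' v" if v: "v \<in> B - C" for v
        using res[of v g] res[of v g'] v eq by (simp add: y_def C_def)
      then show "g = g'" using g by (rule PiE_ext[rotated 2])
    qed
  qed
  then have lower: "CARD('a) ^ card (B - C) \<le> card X"
    by (simp add: card_patterns B_def)

  have "C \<subseteq> (\<lambda>(u, k). side R *s u + k) ` (T \<times> cube n)"
  proof
    fix v assume v: "v \<in> C"
    then have "tile_quo R v \<in> T" using B_W unfolding T_def C_def W by (intro tile_quo_in_cube) auto
    then show "v \<in> (\<lambda>(u, k). side R *s u + k) ` (T \<times> cube n)"
      using v by (intro image_eqI[of _ _ "(tile_quo R v, tile_rem R v)"]) (auto simp: tile_decomp C_def)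
  qed
  then have "card C \<le> card (T \<times> (cube n :: (int ^ 'd) set))"
    by (rule surj_card_le[rotated]) (simp add: T_def)
  then have C: "card C \<le> card T * card (cube n :: (int ^ 'd) set)"
    by (simp add: card_cartesian_product)
  \<comment> \<open>The prescribed sites \<open>C\<close> number at most
    \<open>card (cube n)\<close> per tile; the others are counted by the lower bound on
    \<open>card X\<close>.\<close>
  have "card B \<le> card C + card (B - C)"
    by (subst card_Diff_subset) (auto simp: C_def B_def)
  also have "\<dots> \<le> card T * card (cube n :: (int ^ 'd) set) + card (B - C)" using C by simp
  finally have "CARD('a) ^ card B \<le> CARD('a) ^ (card T * card (cube n :: (int ^ 'd) set) + card (B - C))"
    by (intro power_increasing) (simp_all add: Suc_leI)
  also have "\<dots> = (CARD('a) ^ card (cube n :: (int ^ 'd) set)) ^ card T * CARD('a) ^ card (B - C)"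
    by (simp add: power_add power_mult[symmetric] mult.commute)
  also have "\<dots> \<le> (CARD('a) ^ card (cube n :: (int ^ 'd) set)) ^ card T * card (preimages n w) ^ card T"
    using lower upper by (intro mult_left_mono) auto
  finally show ?thesis
    by (simp add: B_def T_def R_def card_patterns power_mult_distrib)
qed

text \<open>Take logarithms in the tiled count, divide by the number of tiles and let
  \<open>L\<close> tend to infinity: the boundary effects vanish, and the number of sites per tile
  tends to \<open>M ^ CARD('d)\<close>, the size of \<open>cube (n + r)\<close>.\<close>

lemma card_preimages_ge:
  assumes "surj F"
  shows "card (patterns (cube (n + r)) :: ('d, 'a) config set)
    \<le> card (patterns (cube n) :: ('d, 'a) config set) * card (preimages n w)"
proof -
  define M where "M = 2 * (n + r) + 1"
  define N where "N = card (patterns (cube n) :: ('d, 'a) config set) * card (preimages n w)"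
  have *: "CARD('a) ^ ((2 * (M * L + n) + 1) ^ CARD('d)) \<le> N ^ ((2 * L + 1) ^ CARD('d))" for L
    using card_preimages_tiled[OF assms, of n L w] by (simp add: card_cube M_def N_def)
  \<comment> \<open>A single tile already excludes \<open>N = 0\<close>, so \<open>ln N\<close> is
    meaningful below.\<close>
  have N: "N > 0" using *[of 0] by (auto intro!: Nat.gr0I simp: power_0_left)
  have le: "((2 * (M * real L + n) + 1) / (2 * real L + 1)) ^ CARD('d) * ln CARD('a) \<le> ln N" for L
  proof -
    have "real (CARD('a) ^ ((2 * (M * L + n) + 1) ^ CARD('d))) \<le> real (N ^ ((2 * L + 1) ^ CARD('d)))"
      using * by (simp only: of_nat_le_iff)
    then have "ln (real (CARD('a) ^ ((2 * (M * L + n) + 1) ^ CARD('d))))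
        \<le> ln (real (N ^ ((2 * L + 1) ^ CARD('d))))"
      using N by (subst ln_le_cancel_iff) auto
    then have "(2 * (M * real L + n) + 1) ^ CARD('d) * ln CARD('a)
        \<le> (2 * real L + 1) ^ CARD('d) * ln N"
      using N by (simp add: ln_realpow add.commute)
    then show ?thesis by (simp add: power_divide field_simps)
  qed
  have "(\<lambda>L. (2 * (real M * real L + real n) + 1) / (2 * real L + 1)) \<longlonglongrightarrow> real M"
    by real_asymp
  then have "(\<lambda>L. ((2 * (M * real L + n) + 1) / (2 * real L + 1)) ^ CARD('d) * ln CARD('a))
      \<longlonglongrightarrow> M ^ CARD('d) * ln CARD('a)"
    unfolding of_nat_power by (intro tendsto_intros)
  then have "M ^ CARD('d) * ln CARD('a) \<le> ln N"
    by (rule LIMSEQ_le_const2) (use le in blast)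
  then have "ln (real (CARD('a) ^ (M ^ CARD('d)))) \<le> ln N"
    by (simp add: ln_realpow)
  then have "CARD('a) ^ (M ^ CARD('d)) \<le> N"
    using N by (subst (asm) ln_le_cancel_iff) (auto simp flip: of_nat_power)
  then show ?thesis by (simp add: N_def M_def card_patterns card_cube)
qed

text \<open>The balance property. The preimage sets partition the patterns on the larger cube, and
  each is at least of average size; hence all are of average size.\<close>

lemma card_preimages:
  assumes "surj F" "w \<in> patterns (cube n)"
  shows "card (preimages n w) * card (patterns (cube n) :: ('d, 'a) config set)
    = card (patterns (cube (n + r)) :: ('d, 'a) config set)"
proof -
  define P where "P = (patterns (cube n) :: ('d, 'a) config set)"
  define Q where "Q = (patterns (cube (n + r)) :: ('d, 'a) config set)"
  have fin: "finite P" "finite Q" by (simp_all add: P_def Q_def)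
  have pre: "preimages n v = {z \<in> Q. restrict (F z) (cube n) = v}" if "v \<in> P" for v
    using that by (auto simp: preimages_def P_def Q_def restrict_def fun_eq_iff PiE_def extensional_def)
  have "(\<Sum>v\<in>P. card (preimages n v)) = (\<Sum>v\<in>P. \<Sum>z | z \<in> Q \<and> restrict (F z) (cube n) = v. 1)"
    by (simp add: pre)
  also have "\<dots> = (\<Sum>z\<in>Q. 1)"
    by (rule sum.group) (auto simp: fin, simp add: P_def)
  finally have total: "(\<Sum>v\<in>P. card (preimages n v)) = card Q" by simp
  have ge: "card Q \<le> card P * card (preimages n v)" for v
    using card_preimages_ge[OF assms(1)] by (simp add: P_def Q_def)
  have "card P * card Q = card P * (\<Sum>v\<in>P. card (preimages n v))" by (simp add: total)
  also have "\<dots> = (\<Sum>v\<in>P - {w}. card P * card (preimages n v)) + card P * card (preimages n w)"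
    using fin assms(2) by (simp add: sum_distrib_left distrib_left P_def sum.remove[of _ w])
  finally have "card P * card Q
    = (\<Sum>v\<in>P - {w}. card P * card (preimages n v)) + card P * card (preimages n w)" .
  \<comment> \<open>The patterns other than \<open>w\<close> use up at least
    \<open>card P - 1\<close> of the \<open>card P\<close> shares of size \<open>card Q\<close>, so
    at most one share is left for \<open>w\<close>.\<close>
  moreover have "(\<Sum>v\<in>P - {w}. card P * card (preimages n v)) \<ge> (\<Sum>v\<in>P - {w}. card Q)"
    by (intro sum_mono ge)
  moreover have "card P * card Q = (\<Sum>v\<in>P - {w}. card Q) + card Q"
    using fin assms(2) sum.remove[of P w "\<lambda>_. card Q"] by (simp add: P_def)
  ultimately have "card P * card (preimages n w) \<le> card Q" by linarith
  then show ?thesis using ge[of w] by (simp add: P_def Q_def mult.commute)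
qed

end

lemma cellular_automaton_local_map:
  fixes F :: "('d::finite, 'a::finite) config \<Rightarrow> ('d, 'a) config"
  assumes "cellular_automaton F"
  obtains r where "local_map F r"
proof -
  obtain ns f where F: "\<And>x k. F x k = f (map (\<lambda>n. x (k + n)) ns)"
    using assms unfolding cellular_automaton_def by blast
  obtain r where r: "set ns \<subseteq> cube r" using finite_subset_cube[of "set ns"] by auto
  have "local_map F r"
  proof
    show "F (shift a x) = shift a (F x)" for a x
      by (simp add: F shift_def add.assoc fun_eq_iff)
    show "F x k = F y k" if "\<And>j. j \<in> cube (n + r) \<Longrightarrow> x j = y j" "k \<in> cube n" for n x y k
      unfolding F using that r cube_add[of k n _ r] by (intro arg_cong[of _ _ f] map_cong) auto
  qed
  then show ?thesis by (rule that)
qed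

subsection \<open>Cylinder probabilities and weak convergence\<close>

lemma cylinder_in_borel:
  fixes y :: "('d::finite, 'a::{finite, discrete_topology}) config"
  assumes "finite K"
  shows "cylinder K y \<in> sets borel"
proof -
  have "(\<lambda>x :: ('d, 'a) config. x k) \<in> borel \<rightarrow>\<^sub>M count_space UNIV" for k
    using measurable_component_singleton[of k UNIV "\<lambda>_. count_space (UNIV::'a set)"]
    by (simp add: measurable_cong_sets[OF sets_borel_config refl])
  then have "{x \<in> space borel. \<forall>k\<in>K. x k = y k} \<in> sets borel"
    using assms by measurable
  then show ?thesis by (simp add: cylinder_def)
qed

text \<open>The cylinders over \<open>patterns K\<close> partition the space, so a function of the
  coordinates in \<open>K\<close> is a finite combination of their indicators.\<close>

lemma
  fixes h :: "('d::finite, 'a::{finite, discrete_topology}) config \<Rightarrow> real"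
  assumes \<mu>: "borel_prob \<mu>" and K: "finite K" and h: "\<And>x. h (restrict x K) = h x"
  shows integral_finite_support:
      "(\<integral>x. h x \<partial>\<mu>) = (\<Sum>z\<in>patterns K. measure \<mu> (cylinder K z) * h z)"
    and integrable_finite_support: "integrable \<mu> h"
proof -
  interpret prob_space \<mu> using \<mu> by (simp add: borel_prob_def)
  have h_eq: "h = (\<lambda>x. \<Sum>z\<in>patterns K. indicator (cylinder K z) x * h z)"
  proof
    fix x :: "('d, 'a) config"
    have "x \<in> cylinder K z \<longleftrightarrow> z = restrict x K" if "z \<in> patterns K" for z
      using that by (auto simp: cylinder_def PiE_def extensional_def fun_eq_iff restrict_def)
    then have "(\<Sum>z\<in>patterns K. indicator (cylinder K z) x * h z)
        = (\<Sum>z\<in>patterns K. if z = restrict x K then h z else 0)"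
      by (intro sum.cong) (auto simp: indicator_def)
    also have "\<dots> = h x" using K by (simp add: h)
    finally show "h x = (\<Sum>z\<in>patterns K. indicator (cylinder K z) x * h z)" ..
  qed
  have cyl: "cylinder K z \<in> sets \<mu>" for z
    using cylinder_in_borel[OF K] \<mu> by (simp add: borel_prob_def)
  have int: "integrable \<mu> (\<lambda>x. indicator (cylinder K z) x * h z)" for z
    using cyl by (intro integrable_mult_left) (simp add: emeasure_eq_measure)
  show "integrable \<mu> h" by (subst h_eq) (intro Bochner_Integration.integrable_sum int)
  show "(\<integral>x. h x \<partial>\<mu>) = (\<Sum>z\<in>patterns K. measure \<mu> (cylinder K z) * h z)"
    by (subst h_eq, subst Bochner_Integration.integral_sum[OF int])
      (simp add: cyl sets.Int_space_eq2)
qed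

lemma sum_measure_cylinder:
  fixes \<mu> :: "('d::finite, 'a::{finite, discrete_topology}) config measure"
  assumes "borel_prob \<mu>" "finite K"
  shows "(\<Sum>z\<in>patterns K. measure \<mu> (cylinder K z)) = 1"
  using integral_finite_support[OF assms, of "\<lambda>_. 1"] assms(1)
  by (simp add: borel_prob_def prob_space.prob_space)

lemma measure_cylinder_uniform_bernoulli:
  fixes y :: "('d::finite, 'a::{finite, discrete_topology}) config"
  assumes "finite K"
  shows "measure uniform_bernoulli (cylinder K y) = 1 / CARD('a) ^ card K"
proof -
  interpret product_prob_space "\<lambda>_. uniform_count_measure (UNIV::'a set)" "UNIV :: (int ^ 'd) set"
    by (intro product_prob_spaceI prob_space_uniform_count_measure) auto
  have "cylinder K y = prod_emb UNIV (\<lambda>_. uniform_count_measure UNIV) K (\<Pi>\<^sub>E k\<in>K. {y k})"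
    by (auto simp: cylinder_def prod_emb_def space_PiM PiE_def Pi_def restrict_def
        extensional_def space_uniform_count_measure)
  then show ?thesis
    using measure_PiM_emb[of K "\<lambda>k. {y k}"] assms
    by (simp add: uniform_bernoulli_def sets_uniform_count_measure measure_uniform_count_measure
        power_divide)
qed

text \<open>A product measure is determined by its finite boxes, and a box over \<open>J\<close> is
  a finite disjoint union of cylinders over any cube containing \<open>J\<close>.\<close>

lemma uniform_bernoulli_eqI:
  fixes \<mu> :: "('d::finite, 'a::{finite, discrete_topology}) config measure"
  assumes \<mu>: "borel_prob \<mu>"
    and eq: "\<And>n y. y \<in> patterns (cube n) \<Longrightarrow>
      measure \<mu> (cylinder (cube n) y) = measure uniform_bernoulli (cylinder (cube n) y)"
  shows "\<mu> = uniform_bernoulli"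
proof -
  let ?U = "\<lambda>_ :: int ^ 'd. uniform_count_measure (UNIV::'a set)"
  interpret product_prob_space ?U "UNIV :: (int ^ 'd) set"
    by (intro product_prob_spaceI prob_space_uniform_count_measure) auto
  have ub: "borel_prob (uniform_bernoulli :: ('d, 'a) config measure)"
    by (rule borel_prob_uniform_bernoulli)
  have "emeasure \<mu> (prod_emb UNIV ?U J (Pi\<^sub>E J A)) = (\<Prod>j\<in>J. emeasure (?U j) (A j))"
    if J: "finite J" and A: "\<And>j. j \<in> J \<Longrightarrow> A j \<in> sets (?U j)" for J A
  proof -
    let ?E = "prod_emb UNIV ?U J (Pi\<^sub>E J A)"
    have E: "?E = {x. \<forall>j\<in>J. x j \<in> A j}"
      by (auto simp: prod_emb_def space_PiM PiE_def Pi_def restrict_def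
        extensional_def space_uniform_count_measure)
    obtain n where n: "J \<subseteq> cube n" using finite_subset_cube[OF J] by blast
    have ind: "indicat_real ?E (restrict x (cube n)) = indicat_real ?E x" for x
      using n by (auto simp: E indicator_def restrict_def)
    have "measure \<nu> ?E = (\<Sum>z\<in>patterns (cube n). measure \<nu> (cylinder (cube n) z) * indicat_real ?E z)"
      if "borel_prob \<nu>" for \<nu>
    proof -
      have "space \<nu> = UNIV" using that sets_eq_imp_space_eq[of \<nu> borel] by (simp add: borel_prob_def)
      then show ?thesis using integral_finite_support[where h = "indicat_real ?E", OF that finite_cube ind] by simp
    qed
    then have "measure \<mu> ?E = measure uniform_bernoulli ?E" using \<mu> ub eq by simp
    then have "emeasure \<mu> ?E = emeasure uniform_bernoulli ?E"
      using \<mu> ub by (simp add: borel_prob_def prob_space_def finite_measure.emeasure_eq_measure)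
    then show ?thesis
      using emeasure_PiM_emb[of J A] J A by (simp add: uniform_bernoulli_def)
  qed
  then have "\<mu> = Pi\<^sub>M UNIV ?U"
    using \<mu> ub by (intro PiM_eq) (auto simp: borel_prob_def uniform_bernoulli_def)
  then show ?thesis by (simp add: uniform_bernoulli_def)
qed

text \<open>Uniform continuity on a compact space: each point gets a cube on which agreement
  controls \<open>g\<close>, and a finite subcover yields one radius for all points.\<close>

lemma uniform_approximation_by_cube:
  fixes g :: "('d::finite, 'a::{finite, discrete_topology}) config \<Rightarrow> real"
  assumes g: "continuous_on UNIV g" and e: "e > 0"
  shows "\<exists>n. \<forall>x. \<bar>g (restrict x (cube n)) - g x\<bar> < e"
proof -
  have "\<exists>n. \<forall>y\<in>cylinder (cube n) x. \<bar>g y - g x\<bar> < e / 2" for x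
  proof -
    have "open (g -` {g x - e / 2<..<g x + e / 2})"
      using g by (intro open_vimage) auto
    then obtain X where X: "x \<in> (\<Pi>\<^sub>E i\<in>UNIV. X i)" "finite {i. X i \<noteq> UNIV}"
        "(\<Pi>\<^sub>E i\<in>UNIV. X i) \<subseteq> g -` {g x - e / 2<..<g x + e / 2}"
      using product_topology_open_contains_basis[of "\<lambda>_. euclidean" UNIV _ x] e
      unfolding open_fun_def topspace_euclidean by force
    obtain n where n: "{i. X i \<noteq> UNIV} \<subseteq> cube n" using finite_subset_cube[OF X(2)] by blast
    have "\<bar>g y - g x\<bar> < e / 2" if y: "y \<in> cylinder (cube n) x" for y
    proof -
      have "y i \<in> X i" for i
      proof (cases "X i = UNIV")
        case False
        then have "y i = x i" using y n by (auto simp: cylinder_def)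
        then show ?thesis using X(1) by (simp add: PiE_UNIV_domain Pi_def)
      qed simp
      then have "y \<in> (\<Pi>\<^sub>E i\<in>UNIV. X i)" by (simp add: PiE_UNIV_domain Pi_def)
      then have "y \<in> g -` {g x - e / 2<..<g x + e / 2}" using X(3) by blast
      then have "g x - e / 2 < g y" "g y < g x + e / 2" by simp_all
      then show ?thesis by linarith
    qed
    then show ?thesis by blast
  qed
  then obtain N where N: "\<And>x y. y \<in> cylinder (cube (N x)) x \<Longrightarrow> \<bar>g y - g x\<bar> < e / 2" by metis
  \<comment> \<open>Tychonoff's theorem with a finite alphabet.\<close>
  have "compact_space (product_topology (\<lambda>_ :: int ^ 'd. euclidean :: 'a topology) UNIV)"
    unfolding compact_space_product_topology
    by (auto simp: compact_space_def compactin_euclidean_iff intro!: finite_imp_compact)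
  then have comp: "compact (UNIV :: ('d, 'a) config set)"
    by (simp add: euclidean_product_topology compact_space_def compactin_euclidean_iff)
  have opn: "open (cylinder (cube n) x)" for n and x :: "('d, 'a) config"
  proof -
    have "cylinder (cube n) x = (\<Pi>\<^sub>E k\<in>UNIV. if k \<in> cube n then {x k} else UNIV)"
      by (auto simp: cylinder_def PiE_UNIV_domain Pi_def)
    then show ?thesis
      using finite_subset[OF _ finite_cube[of n]]
      by (auto intro!: open_PiE Topological_Spaces.open_discrete)
  qed
  have "UNIV \<subseteq> (\<Union>x\<in>UNIV. cylinder (cube (N x)) x)" by (auto simp: cylinder_def)
  then obtain C where C: "finite C" "UNIV \<subseteq> (\<Union>x\<in>C. cylinder (cube (N x)) x)"
    by (rule compactE_image[OF comp, rotated]) (auto intro: opn)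
  define n where "n = Max (N ` C)"
  have "\<bar>g (restrict y (cube n)) - g y\<bar> < e" for y
  proof -
    obtain x where x: "x \<in> C" "y \<in> cylinder (cube (N x)) x" using C by blast
    then have "cube (N x) \<subseteq> (cube n :: (int ^ 'd) set)"
      unfolding n_def using C(1) by (intro cube_mono) auto
    then have "restrict y (cube n) \<in> cylinder (cube (N x)) x"
      using x(2) by (auto simp: cylinder_def)
    \<comment> \<open>Both \<open>y\<close> and its restriction lie in the cylinder around
      \<open>x\<close>, so the two errors of \<open>e / 2\<close> add up to
      \<open>e\<close>.\<close>
    then show ?thesis using N[OF x(2)] N[of "restrict y (cube n)" x] by linarith
  qed
  then show ?thesis by blast
qed

text \<open>\<open>g\<close> is replaced by a function of finitely many coordinates. The error is
  uniform over probability measures, so convergence on cylinders suffices.\<close>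

lemma weakly_convergesI:
  fixes \<mu> :: "nat \<Rightarrow> ('d::finite, 'a::{finite, discrete_topology}) config measure"
  assumes \<mu>: "\<And>t. borel_prob (\<mu> t)" and \<nu>: "borel_prob \<nu>"
    and conv: "\<And>n y. y \<in> patterns (cube n) \<Longrightarrow>
      (\<lambda>t. measure (\<mu> t) (cylinder (cube n) y)) \<longlonglongrightarrow> measure \<nu> (cylinder (cube n) y)"
  shows "weakly_converges \<mu> \<nu>"
  unfolding weakly_converges_def
proof (intro allI impI)
  fix g :: "('d, 'a) config \<Rightarrow> real"
  assume g: "continuous_on UNIV g \<and> bounded (range g)"
  then obtain B where B: "\<And>x. \<bar>g x\<bar> \<le> B" by (auto simp: bounded_iff)
  have int: "integrable \<rho> g" if "borel_prob \<rho>" for \<rho>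
  proof -
    interpret prob_space \<rho> using that by (simp add: borel_prob_def)
    have "g \<in> borel_measurable \<rho>"
      using that borel_measurable_continuous_onI[of g] g
      by (simp add: borel_prob_def cong: measurable_cong_sets)
    then show ?thesis using B by (intro integrable_const_bound[of _ B]) auto
  qed
  show "(\<lambda>n. \<integral>x. g x \<partial>\<mu> n) \<longlonglongrightarrow> (\<integral>x. g x \<partial>\<nu>)"
  proof (rule LIMSEQ_I)
    fix e :: real assume e: "e > 0"
    obtain n where n: "\<And>x. \<bar>g (restrict x (cube n)) - g x\<bar> < e / 3"
      using uniform_approximation_by_cube[of g "e / 3"] g e by auto
    define h where "h x = g (restrict x (cube n))" for x
    have hr: "h (restrict x (cube n)) = h x" for x by (simp add: h_def)
    have approx: "\<bar>(\<integral>x. h x \<partial>\<rho>) - (\<integral>x. g x \<partial>\<rho>)\<bar> \<le> e / 3" if \<rho>: "borel_prob \<rho>" for \<rho>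
    proof -
      interpret prob_space \<rho> using \<rho> by (simp add: borel_prob_def)
      have ih: "integrable \<rho> h" by (rule integrable_finite_support[where h = h, OF \<rho> finite_cube hr])
      have "\<bar>\<integral>x. h x - g x \<partial>\<rho>\<bar> \<le> (\<integral>x. \<bar>h x - g x\<bar> \<partial>\<rho>)" by (rule integral_abs_bound)
      also have "\<dots> \<le> (\<integral>x. e / 3 \<partial>\<rho>)"
      proof (rule integral_mono)
        show "integrable \<rho> (\<lambda>x. \<bar>h x - g x\<bar>)"
          by (intro integrable_abs Bochner_Integration.integrable_diff ih int[OF \<rho>])
        show "\<bar>h x - g x\<bar> \<le> e / 3" for x using n[of x] by (simp add: h_def)
      qed simp
      finally show ?thesis using ih int[OF \<rho>] by (simp add: prob_space)
    qed
    have "(\<lambda>t. \<Sum>z\<in>patterns (cube n). measure (\<mu> t) (cylinder (cube n) z) * h z)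
        \<longlonglongrightarrow> (\<Sum>z\<in>patterns (cube n). measure \<nu> (cylinder (cube n) z) * h z)"
      by (intro tendsto_intros conv)
    then have "(\<lambda>t. \<integral>x. h x \<partial>\<mu> t) \<longlonglongrightarrow> (\<integral>x. h x \<partial>\<nu>)"
      by (simp add: integral_finite_support[where h = h, OF \<mu> finite_cube hr] integral_finite_support[where h = h, OF \<nu> finite_cube hr])
    from LIMSEQ_D[OF this, of "e / 3"] e obtain T where
      T: "\<And>t. t \<ge> T \<Longrightarrow> \<bar>(\<integral>x. h x \<partial>\<mu> t) - (\<integral>x. h x \<partial>\<nu>)\<bar> < e / 3" by auto
    have "norm ((\<integral>x. g x \<partial>\<mu> t) - (\<integral>x. g x \<partial>\<nu>)) < e" if "t \<ge> T" for t
      using T[OF that] approx[OF \<mu>[of t]] approx[OF \<nu>] unfolding real_norm_def by linarith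
    then show "\<exists>no. \<forall>t\<ge>no. norm ((\<integral>x. g x \<partial>\<mu> t) - (\<integral>x. g x \<partial>\<nu>)) < e" by blast
  qed
qed

subsection \<open>Decay of the deficit\<close>

definition cube_deficit :: "('d::finite, 'a::finite) config measure \<Rightarrow> nat \<Rightarrow> real" where
  "cube_deficit \<mu> n = deficit (patterns (cube n)) (\<lambda>y. measure \<mu> (cylinder (cube n) y))"

lemma cube_deficit_nonneg: "0 \<le> cube_deficit \<mu> n"
  unfolding cube_deficit_def by (rule deficit_nonneg) simp_all

text \<open>Shannon entropy is nonnegative, so the deficit is at most the logarithm of the number of
  patterns. Only polynomial growth in \<open>n\<close> matters, since it is set against a geometric
  factor.\<close>

lemma cube_deficit_le:
  fixes \<mu> :: "('d::finite, 'a::{finite, discrete_topology}) config measure"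
  assumes "borel_prob \<mu>"
  shows "cube_deficit \<mu> n \<le> (2 * real n + 1) ^ CARD('d) * ln CARD('a)"
proof -
  interpret prob_space \<mu> using assms by (simp add: borel_prob_def)
  have "(\<Sum>y\<in>patterns (cube n). prob (cylinder (cube n) y) * ln (prob (cylinder (cube n) y))) \<le> 0"
  proof (rule sum_nonpos)
    show "prob A * ln (prob A) \<le> 0" for A
      by (cases "prob A = 0") (simp_all add: mult_nonneg_nonpos zero_less_measure_iff)
  qed
  then show ?thesis
    by (simp add: cube_deficit_def deficit_def sum_measure_cylinder[OF assms] card_patterns card_cube ln_realpow add.commute)
qed

lemma cube_deficit_bound_pointwise:
  fixes \<mu> :: "('d::finite, 'a::{finite, discrete_topology}) config measure"
  assumes "borel_prob \<mu>" "y \<in> patterns (cube n)"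
  shows "(sqrt (CARD('a) ^ card (cube n :: (int ^ 'd) set) * measure \<mu> (cylinder (cube n) y)) - 1)\<^sup>2
    \<le> CARD('a) ^ card (cube n :: (int ^ 'd) set) * cube_deficit \<mu> n"
  using deficit_bound_pointwise[OF _ _ sum_measure_cylinder[OF assms(1)] assms(2)]
  by (simp add: cube_deficit_def card_patterns)

lemma perturbation_borel_prob:
  assumes "is_perturbation F \<theta> \<Phi>" "borel_prob \<mu>"
  shows "borel_prob (\<mu> \<bind> \<Phi>)"
proof -
  have "\<mu> \<in> space (prob_algebra borel)" "\<Phi> \<in> borel \<rightarrow>\<^sub>M prob_algebra borel"
    using assms by (auto simp: space_prob_algebra borel_prob_def is_perturbation_def)
  from prob_space_bind'[OF this] sets_bind'[OF this] show ?thesis by (simp add: borel_prob_def)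
qed

text \<open>The marginal on \<open>cube n\<close> after one step is the marginal on
  \<open>cube (n + r)\<close> pushed through \<open>F\<close>, then hit by independent noise.
  Balance gives data processing for the first operation, tensorised contraction handles the
  second.\<close>

lemma cube_deficit_step:
  fixes F :: "('d::finite, 'a::{finite, discrete_topology}) config \<Rightarrow> ('d, 'a) config"
  assumes "local_map F r" "surj F" and \<Phi>: "is_perturbation F \<theta> \<Phi>" and \<theta>: "contracts UNIV \<theta> c" "0 \<le> c" "c \<le> 1"
    and \<mu>: "borel_prob \<mu>"
  shows "cube_deficit (\<mu> \<bind> \<Phi>) n \<le> c * cube_deficit \<mu> (n + r)"
proof -
  interpret local_map F r by fact
  interpret prob_space \<mu> using \<mu> by (simp add: borel_prob_def)
  define K where "K = (cube n :: (int ^ 'd) set)"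
  define B where "B = (cube (n + r) :: (int ^ 'd) set)"
  define p where "p z = measure \<mu> (cylinder B z)" for z
  define \<pi> where "\<pi> z = restrict (F z) K" for z
  define P where "P w = (\<Sum>z | z \<in> patterns B \<and> \<pi> z = w. p z)" for w
  have K: "finite K" and B: "finite B" by (simp_all add: K_def B_def)
  \<comment> \<open>Given \<open>F x\<close> the noise is independent over sites, and
    \<open>F x\<close> on \<open>K\<close> depends only on \<open>x\<close> on \<open>B\<close>;
    grouping the patterns on \<open>B\<close> by their image produces \<open>P\<close>.\<close>
  have meas: "measure (\<mu> \<bind> \<Phi>) (cylinder K y) = (\<Sum>w\<in>patterns K. P w * (\<Prod>k\<in>K. \<theta> (w k) (y k)))" for y
  proof -
    have "\<Phi> \<in> borel \<rightarrow>\<^sub>M subprob_algebra borel"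
      using \<Phi> by (auto simp: is_perturbation_def intro: measurable_prob_algebraD)
    then have "\<Phi> \<in> \<mu> \<rightarrow>\<^sub>M subprob_algebra borel"
      using \<mu> by (simp add: borel_prob_def cong: measurable_cong_sets)
    then have "measure (\<mu> \<bind> \<Phi>) (cylinder K y) = (\<integral>x. measure (\<Phi> x) (cylinder K y) \<partial>\<mu>)"
      by (rule measure_bind) (rule cylinder_in_borel[OF K])
    also have "\<dots> = (\<integral>x. (\<Prod>k\<in>K. \<theta> (F x k) (y k)) \<partial>\<mu>)"
      using \<Phi> K by (simp add: is_perturbation_def)
    also have "\<dots> = (\<Sum>z\<in>patterns B. p z * (\<Prod>k\<in>K. \<theta> (F z k) (y k)))"
      unfolding p_def by (rule integral_finite_support[OF \<mu> B])
        (simp add: K_def B_def local_restrict)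
    also have "\<dots> = (\<Sum>z\<in>patterns B. p z * (\<Prod>k\<in>K. \<theta> (\<pi> z k) (y k)))"
      by (simp add: \<pi>_def)
    also have "\<dots> = (\<Sum>w\<in>patterns K. \<Sum>z | z \<in> patterns B \<and> \<pi> z = w. p z * (\<Prod>k\<in>K. \<theta> (\<pi> z k) (y k)))"
      using K B by (intro sum.group[symmetric]) (auto simp: \<pi>_def)
    also have "\<dots> = (\<Sum>w\<in>patterns K. P w * (\<Prod>k\<in>K. \<theta> (w k) (y k)))"
      by (simp add: P_def sum_distrib_right)
    finally show ?thesis .
  qed
  have card_fib: "card {z \<in> patterns B. \<pi> z = w} * card (patterns K :: ('d, 'a) config set)
      = card (patterns B :: ('d, 'a) config set)" if w: "w \<in> patterns K" for w
  proof -
    have "{z \<in> patterns B. \<pi> z = w} = preimages n w"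
      using w by (auto simp: preimages_def \<pi>_def K_def B_def restrict_def fun_eq_iff PiE_def extensional_def)
    then show ?thesis using card_preimages[OF assms(2), of w n] w by (simp add: K_def B_def)
  qed
  have "cube_deficit (\<mu> \<bind> \<Phi>) n = deficit (patterns K) (\<lambda>y. \<Sum>w\<in>patterns K. P w * (\<Prod>k\<in>K. \<theta> (w k) (y k)))"
    unfolding cube_deficit_def K_def[symmetric] meas ..
  also have "\<dots> \<le> c * deficit (patterns K) P"
  proof -
    have "0 \<le> P w" for w by (auto simp: P_def p_def intro: sum_nonneg)
    then show ?thesis using contracts_patterns[OF K \<theta>] unfolding contracts_def by simp
  qed
  also have "\<dots> \<le> c * deficit (patterns B) p"
  proof (rule mult_left_mono[OF _ \<theta>(2)])
    have ne: "patterns B \<noteq> ({} :: ('d, 'a) config set)" by (simp add: PiE_eq_empty_iff)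
    have "deficit (patterns B) p = deficit (patterns K) P
      + (\<Sum>w\<in>patterns K. deficit {z \<in> patterns B. \<pi> z = w} p)"
      unfolding P_def using K B
      by (intro deficit_fibers card_fib ne finite_patterns) (auto simp: \<pi>_def)
    moreover have "0 \<le> (\<Sum>w\<in>patterns K. deficit {z \<in> patterns B. \<pi> z = w} p)"
      using B by (intro sum_nonneg deficit_nonneg) (auto simp: p_def)
    ultimately show "deficit (patterns K) P \<le> deficit (patterns B) p" by linarith
  qed
  also have "deficit (patterns B) p = cube_deficit \<mu> (n + r)"
    by (simp add: cube_deficit_def B_def p_def[abs_def])
  finally show ?thesis .
qed

theorem theorem4p1:
  fixes F :: "('d::finite, 'a::{finite, ab_group_add, discrete_topology}) config \<Rightarrow> ('d, 'a) config"
    and q :: "'a pmf"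
    and \<Phi> :: "('d, 'a) config \<Rightarrow> ('d, 'a) config measure"
  assumes "cellular_automaton F"
    and "surj F"
    and "positive_noise q"
    and "is_perturbation F (additive_noise q) \<Phi>"
  shows "invariant_under uniform_bernoulli \<Phi> \<and>
    (\<forall>\<mu> :: ('d, 'a) config measure. borel_prob \<mu> \<and> shift_invariant \<mu> \<longrightarrow>
       weakly_converges (kernel_iterate \<mu> \<Phi>) uniform_bernoulli)"
proof -
  obtain r where r: "local_map F r" using assms(1) by (rule cellular_automaton_local_map)
  \<comment> \<open>Half the minimum keeps \<open>c\<close> positive even for uniform
    \<open>q\<close>; positivity of \<open>c\<close> enters the asymptotics of
    \<open>c ^ t\<close>.\<close>
  define m where "m = Min (range (pmf q)) / 2"
  define c where "c = 1 - CARD('a) * m"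
  have m0: "m > 0" using assms(3) by (auto simp: m_def positive_noise_def)
  have m_le: "2 * m \<le> pmf q b" for b by (auto simp: m_def)
  have "(\<Sum>b\<in>(UNIV :: 'a set). 2 * m) \<le> (\<Sum>b\<in>UNIV. pmf q b)" by (intro sum_mono m_le)
  also have "(\<Sum>b\<in>UNIV. pmf q b) = 1" by (rule sum_pmf_eq_1) auto
  finally have c: "0 < c" "c < 1" using m0 by (auto simp: c_def)
  have "m \<le> pmf q b" for b using m_le[of b] m0 by simp
  then have contr: "contracts UNIV (additive_noise q) c"
    unfolding c_def using m0 by (intro contracts_additive_noise) auto
  note step = cube_deficit_step[OF r assms(2,4) contr less_imp_le[OF c(1)] less_imp_le[OF c(2)]]
  define \<beta> where "\<beta> = (uniform_bernoulli :: ('d, 'a) config measure)"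
  define N where "N n = real CARD('a) ^ card (cube n :: (int ^ 'd) set)" for n
  have N: "N n > 0" for n by (simp add: N_def)
  have \<beta>: "borel_prob \<beta>" unfolding \<beta>_def by (rule borel_prob_uniform_bernoulli)
  have \<beta>_cyl: "measure \<beta> (cylinder (cube n) y) = 1 / N n" for n y
    by (simp add: \<beta>_def N_def measure_cylinder_uniform_bernoulli)
  have bound: "(sqrt (N n * measure \<mu> (cylinder (cube n) y)) - 1)\<^sup>2 \<le> N n * cube_deficit \<mu> n"
    if "borel_prob \<mu>" "y \<in> patterns (cube n)" for n y and \<mu> :: "('d, 'a) config measure"
    unfolding N_def using cube_deficit_bound_pointwise[OF that] by simp

  \<comment> \<open>Invariance of the uniform Bernoulli measure\<close>
  have "cube_deficit \<beta> n = 0" for n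
    using deficit_const[of "patterns (cube n) :: ('d, 'a) config set" "1 / N n"] N[of n]
    by (simp add: cube_deficit_def \<beta>_cyl PiE_eq_empty_iff)
  \<comment> \<open>Zero deficit on every cube persists through a step, and by the pointwise bound
    it fixes every cylinder probability.\<close>
  then have D0: "cube_deficit (\<beta> \<bind> \<Phi>) n = 0" for n
    using step[OF \<beta>, of n] cube_deficit_nonneg[of "\<beta> \<bind> \<Phi>" n] by simp
  have inv: "\<beta> \<bind> \<Phi> = \<beta>"
    unfolding \<beta>_def
  proof (rule uniform_bernoulli_eqI, unfold \<beta>_def[symmetric])
    show \<beta>\<Phi>: "borel_prob (\<beta> \<bind> \<Phi>)" using assms(4) \<beta> by (rule perturbation_borel_prob)
    fix n and y :: "('d, 'a) config" assume "y \<in> patterns (cube n)"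
    then have "sqrt (N n * measure (\<beta> \<bind> \<Phi>) (cylinder (cube n) y)) = 1"
      using bound[OF \<beta>\<Phi>, of y n] D0[of n] by simp
    then show "measure (\<beta> \<bind> \<Phi>) (cylinder (cube n) y) = measure \<beta> (cylinder (cube n) y)"
      using N[of n] by (simp add: \<beta>_cyl field_simps)
  qed

  \<comment> \<open>Convergence to the uniform Bernoulli measure\<close>
  have "weakly_converges (kernel_iterate \<mu> \<Phi>) \<beta>" if \<mu>: "borel_prob \<mu>" for \<mu>
  proof (rule weakly_convergesI)
    show bp: "borel_prob (kernel_iterate \<mu> \<Phi> t)" for t
      by (induction t) (simp_all add: kernel_iterate_def \<mu> perturbation_borel_prob[OF assms(4)])
    show "borel_prob \<beta>" by fact
    have iter: "cube_deficit (kernel_iterate \<mu> \<Phi> t) n \<le> c ^ t * cube_deficit \<mu> (n + t * r)" for t n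
    proof (induction t arbitrary: n)
      case (Suc t)
      have "cube_deficit (kernel_iterate \<mu> \<Phi> (Suc t)) n
          \<le> c * cube_deficit (kernel_iterate \<mu> \<Phi> t) (n + r)"
        using step[OF bp[of t], of n] by (simp add: kernel_iterate_def)
      also have "\<dots> \<le> c * (c ^ t * cube_deficit \<mu> (n + r + t * r))"
        using c by (intro mult_left_mono Suc) auto
      finally show ?case by (simp add: algebra_simps)
    qed (simp add: kernel_iterate_def)
    fix n and y :: "('d, 'a) config" assume y: "y \<in> patterns (cube n)"
    let ?p = "\<lambda>t. measure (kernel_iterate \<mu> \<Phi> t) (cylinder (cube n) y)"
    define b where "b t = N n * (c ^ t * ((2 * real (n + t * r) + 1) ^ CARD('d) * ln CARD('a)))" for t
    have le_b: "(sqrt (N n * ?p t) - 1)\<^sup>2 \<le> b t" for t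
    proof -
      have "(sqrt (N n * ?p t) - 1)\<^sup>2 \<le> N n * cube_deficit (kernel_iterate \<mu> \<Phi> t) n"
        using bp y by (rule bound)
      also have "\<dots> \<le> N n * (c ^ t * cube_deficit \<mu> (n + t * r))"
        using N[of n] iter by (intro mult_left_mono) auto
      also have "\<dots> \<le> b t"
        unfolding b_def using N[of n] c \<mu> by (intro mult_left_mono cube_deficit_le) auto
      finally show ?thesis .
    qed
    have b0: "b \<longlonglongrightarrow> 0"
    proof -
      have "(\<lambda>t. c ^ t * (2 * (real n + real t * real r) + 1) ^ CARD('d)) \<longlonglongrightarrow> 0"
      proof -
        \<comment> \<open>With this root the expression is the \<open>CARD('d)\<close>-th power of a
          geometric sequence times a linear one, so the limit needs no symbolic exponent.\<close>
        define c' where "c' = root CARD('d) c"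
        have c': "0 < c'" "c' < 1" "c = c' ^ CARD('d)" using c by (simp_all add: c'_def)
        have "(\<lambda>t. c' ^ t * (2 * (real n + real t * real r) + 1)) \<longlonglongrightarrow> 0"
          using c'(1,2) by real_asymp
        then have "(\<lambda>t. (c' ^ t * (2 * (real n + real t * real r) + 1)) ^ CARD('d)) \<longlonglongrightarrow> 0 ^ CARD('d)"
          by (rule tendsto_power)
        then show ?thesis
          by (simp add: power_mult_distrib c'(3) zero_power mult.commute flip: power_mult)
      qed
      then have "(\<lambda>t. N n * ln CARD('a) * (c ^ t * (2 * (real n + real t * real r) + 1) ^ CARD('d)))
          \<longlonglongrightarrow> N n * ln CARD('a) * 0" by (intro tendsto_intros)
      then show ?thesis unfolding b_def by (simp add: algebra_simps)
    qed
    have "(\<lambda>t. (sqrt (N n * ?p t) - 1)\<^sup>2) \<longlonglongrightarrow> 0"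
      by (rule tendsto_sandwich[OF _ _ tendsto_const b0]) (use le_b in auto)
    then have "(\<lambda>t. sqrt ((sqrt (N n * ?p t) - 1)\<^sup>2)) \<longlonglongrightarrow> sqrt 0" by (rule tendsto_real_sqrt)
    then have "(\<lambda>t. sqrt (N n * ?p t) - 1) \<longlonglongrightarrow> 0"
      by (simp add: tendsto_rabs_zero_iff)
    \<comment> \<open>Squaring and dividing by \<open>N n\<close> recovers \<open>?p t\<close> from
      \<open>sqrt (N n * ?p t)\<close>.\<close>
    then have "(\<lambda>t. (sqrt (N n * ?p t) - 1 + 1)\<^sup>2 / N n) \<longlonglongrightarrow> (0 + 1)\<^sup>2 / N n"
      using N[of n] by (intro tendsto_intros) auto
    then show "?p \<longlonglongrightarrow> measure \<beta> (cylinder (cube n) y)"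
      using N[of n] by (simp add: \<beta>_cyl)
  qed
  then show ?thesis using inv by (simp add: invariant_under_def \<beta>_def)
qed

end
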